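(* Suppose that $f$ is a parabolic Möbius transformation and $g$ is a hyperbolic Möbius transformation such that the semigroup $\langle f,g\rangle$ is nonelementary. Then $\mathrm{tr}[f,g]>2$, and $\langle f,g\rangle$ is semidiscrete and inverse free if and only if $f^ng$ is not elliptic for every integer $n$ with $1\leq n\leq 2\,\mathrm{tr}(g)/\sqrt{\mathrm{tr}[f,g]-2}$. Furthermore, if $f$ and $g$ are antiparallel, and $\langle f,g\rangle$ is semidiscrete and inverse free, then $\langle f,g\rangle$ is contained in a Schottky group of rank two.
   Context: $\mathbb{H}$ is the upper half-plane, $\overline{\mathbb{R}}=\mathbb{R}\cup\{\infty\}$, $\overline{\mathbb{H}}=\mathbb{H}\cup\overline{\mathbb{R}}$. "Möbius transformation" means $z\mapsto (az+b)/(cz+d)$ with $a,b,c,d\in\mathbb{R}$, $ad-bc>0$; these form the topological group $\mathcal{M}\cong\mathrm{PSL}(2,\mathbb{R})$ with identity $I$. $\langle f,g\rangle$ denotes the semigroup (not the group) generated by $f$ and $g$, i.e. all finite compositions of copies of $f$ and $g$. A semigroup $S$ is semidiscrete if $I$ is not an accumulation point of $S$ in $\mathcal{M}$, and inverse free if $I\notin S$. $S$ is elementary if it has a finite orbit in its action on $\overline{\mathbb{H}}$, and nonelementary otherwise. If $f(z)=(az+b)/(cz+d)$ with $ad-bc=1$, then $\mathrm{tr}(f)=|a+d|$; $[f,g]=fgf^{-1}g^{-1}$. For hyperbolic $h$, $\alpha_h$ is the attracting fixed point of $h$; for parabolic $h$, $\alpha_h$ is the unique fixed point of $h$. A closed interval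 is a closed interval in the circle $\overline{\mathbb{R}}$ that is neither a singleton nor all of $\overline{\mathbb{R}}$; $h$ maps $J$ strictly inside itself if $h(J)\subset J$ and $h(J)\neq J$. Two transformations $f,g$, each parabolic or hyperbolic, with no fixed points in common, are antiparallel if neither one of the two closed intervals with end points $\alpha_f$ and $\alpha_g$ is mapped strictly inside itself by both $f$ and $g$. A Schottky group of rank two is a group generated (as a group) by two Möbius transformations $f_1,f_2$ for which there are pairwise disjoint open intervals $A,B,C,D$ in $\overline{\mathbb{R}}$ such that $f_1$ maps the complement of $\overline{A}$ onto $B$ and $f_2$ maps the complement of $\overline{C}$ onto $D$. *)

theory Defs
  imports "HOL-Analysis.Analysis" "HOL-Algebra.Generated_Groups"
begin

no_notation eq_closure_of (\<open>closure'_of\<index>\<close>)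

section \<open>The Riemann sphere and the closed hyperbolic plane\<close>

text \<open>The Riemann sphere is the type \<^typ>\<open>complex option\<close>, where \<^term>\<open>None\<close> is the point at
  infinity. The extended real line and the (closed) upper half-plane are subsets of it.\<close>

definition sphere_topology :: "complex option topology" where
  "sphere_topology = Alexandroff_compactification euclidean"

definition ext_real :: "complex option set" where
  "ext_real = insert None (Some ` \<real>)"

definition half_plane :: "complex option set" where
  "half_plane = Some ` {z. Im z > 0}"

definition closed_half_plane :: "complex option set" where
  "closed_half_plane = half_plane \<union> ext_real"

definition circle_topology :: "complex option topology" where
  "circle_topology = subtopology sphere_topology ext_real"

definition closed_interval :: "complex option set \<Rightarrow> bool" where
  "closed_interval J \<longleftrightarrow> closedin circle_topology J \<and> connectedin circle_topology J \<and>
     J \<noteq> {} \<and> \<not> is_singleton J \<and> J \<noteq> ext_real"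

definition open_interval :: "complex option set \<Rightarrow> bool" where
  "open_interval J \<longleftrightarrow> openin circle_topology J \<and> connectedin circle_topology J \<and>
     J \<noteq> {} \<and> J \<noteq> ext_real"

definition end_points :: "complex option set \<Rightarrow> complex option set" where
  "end_points J = circle_topology frontier_of J"


section \<open>The group of real Moebius transformations\<close>

definition moebius_map :: "real^2^2 \<Rightarrow> complex option \<Rightarrow> complex option" where
  "moebius_map A z =
     (let a = of_real (A $ 1 $ 1); b = of_real (A $ 1 $ 2);
          c = of_real (A $ 2 $ 1); d = of_real (A $ 2 $ 2)
      in case z of
           None \<Rightarrow> if c = 0 then None else Some (a / c)
         | Some w \<Rightarrow> if c * w + d = 0 then None else Some (moebius a b c d w))"

definition moebius_group :: "(complex option \<Rightarrow> complex option) monoid" where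
  "moebius_group = \<lparr>carrier = moebius_map ` {A. det A > 0}, monoid.mult = (\<circ>), one = id\<rparr>"

definition SL2 :: "(real^2^2) set" where
  "SL2 = {A. det A = 1}"

text \<open>The topology of $\mathrm{PSL}(2,\mathbb{R})$, i.e. the quotient topology coming from
  $\mathrm{SL}(2,\mathbb{R})$; see \<open>quotient_map_moebius_map\<close> below.\<close>

definition moebius_topology :: "(complex option \<Rightarrow> complex option) topology" where
  "moebius_topology = topology (\<lambda>U. U \<subseteq> carrier moebius_group \<and>
     openin (top_of_set SL2) {A \<in> SL2. moebius_map A \<in> U})"

text \<open>The representing matrix of determinant 1 is unique up to sign, so the following is
  well defined; see \<open>tr_moebius_map\<close> below.\<close>

definition tr :: "(complex option \<Rightarrow> complex option) \<Rightarrow> real" where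
  "tr f = (THE t. \<exists>A. det A = 1 \<and> moebius_map A = f \<and> t = \<bar>trace A\<bar>)"

definition commutator ::
  "(complex option \<Rightarrow> complex option) \<Rightarrow> (complex option \<Rightarrow> complex option) \<Rightarrow>
   (complex option \<Rightarrow> complex option)" where
  "commutator f g =
     f \<otimes>\<^bsub>moebius_group\<^esub> g \<otimes>\<^bsub>moebius_group\<^esub> inv\<^bsub>moebius_group\<^esub> f \<otimes>\<^bsub>moebius_group\<^esub> inv\<^bsub>moebius_group\<^esub> g"

definition elliptic :: "(complex option \<Rightarrow> complex option) \<Rightarrow> bool" where
  "elliptic f \<longleftrightarrow> f \<in> carrier moebius_group \<and> (\<exists>!p. p \<in> half_plane \<and> f p = p)"

definition parabolic :: "(complex option \<Rightarrow> complex option) \<Rightarrow> bool" where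
  "parabolic f \<longleftrightarrow> f \<in> carrier moebius_group \<and> (\<exists>!p. p \<in> ext_real \<and> f p = p)"

definition hyperbolic :: "(complex option \<Rightarrow> complex option) \<Rightarrow> bool" where
  "hyperbolic f \<longleftrightarrow> f \<in> carrier moebius_group \<and> card {p \<in> ext_real. f p = p} = 2"

text \<open>For hyperbolic \<open>h\<close>, the attracting fixed point is the fixed point to which every point of
  the closed half-plane other than the fixed points of \<open>h\<close> is drawn under iteration.\<close>

definition attracting_fixed_point :: "(complex option \<Rightarrow> complex option) \<Rightarrow> complex option" where
  "attracting_fixed_point h = (THE p. p \<in> ext_real \<and> h p = p \<and>
     (\<forall>z \<in> closed_half_plane. h z \<noteq> z \<longrightarrow>
        limitin sphere_topology (\<lambda>n. (h ^^ n) z) p sequentially))"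

definition alpha :: "(complex option \<Rightarrow> complex option) \<Rightarrow> complex option" where
  "alpha h = (if hyperbolic h then attracting_fixed_point h
              else (THE p. p \<in> ext_real \<and> h p = p))"

definition maps_strictly_inside ::
  "(complex option \<Rightarrow> complex option) \<Rightarrow> complex option set \<Rightarrow> bool" where
  "maps_strictly_inside h J \<longleftrightarrow> h ` J \<subset> J"

definition antiparallel ::
  "(complex option \<Rightarrow> complex option) \<Rightarrow> (complex option \<Rightarrow> complex option) \<Rightarrow> bool" where
  "antiparallel f g \<longleftrightarrow>
     (parabolic f \<or> hyperbolic f) \<and> (parabolic g \<or> hyperbolic g) \<and>
     \<not> (\<exists>p \<in> closed_half_plane. f p = p \<and> g p = p) \<and>
     \<not> (\<exists>J. closed_interval J \<and> end_points J = {alpha f, alpha g} \<and>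
          maps_strictly_inside f J \<and> maps_strictly_inside g J)"


section \<open>Semigroups of Moebius transformations\<close>

inductive_set semigroup_generated :: "('a, 'b) monoid_scheme \<Rightarrow> 'a set \<Rightarrow> 'a set"
  for G and H where
  incl: "h \<in> H \<Longrightarrow> h \<in> semigroup_generated G H"
| mult: "h1 \<in> semigroup_generated G H \<Longrightarrow> h2 \<in> semigroup_generated G H \<Longrightarrow>
    h1 \<otimes>\<^bsub>G\<^esub> h2 \<in> semigroup_generated G H"

abbreviation moebius_semigroup ::
  "(complex option \<Rightarrow> complex option) \<Rightarrow> (complex option \<Rightarrow> complex option) \<Rightarrow>
   (complex option \<Rightarrow> complex option) set" where
  "moebius_semigroup f g \<equiv> semigroup_generated moebius_group {f, g}"

definition semidiscrete :: "(complex option \<Rightarrow> complex option) set \<Rightarrow> bool" where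
  "semidiscrete S \<longleftrightarrow> \<one>\<^bsub>moebius_group\<^esub> \<notin> moebius_topology derived_set_of S"

definition inverse_free :: "(complex option \<Rightarrow> complex option) set \<Rightarrow> bool" where
  "inverse_free S \<longleftrightarrow> \<one>\<^bsub>moebius_group\<^esub> \<notin> S"

definition elementary :: "(complex option \<Rightarrow> complex option) set \<Rightarrow> bool" where
  "elementary S \<longleftrightarrow> (\<exists>z \<in> closed_half_plane. finite {h z | h. h \<in> S})"

definition Schottky_rank_two :: "(complex option \<Rightarrow> complex option) set \<Rightarrow> bool" where
  "Schottky_rank_two \<Gamma> \<longleftrightarrow>
     (\<exists>f1 \<in> carrier moebius_group. \<exists>f2 \<in> carrier moebius_group.
        \<Gamma> = generate moebius_group {f1, f2} \<and>
        (\<exists>A B C D. open_interval A \<and> open_interval B \<and> open_interval C \<and> open_interval D \<and>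
           disjnt A B \<and> disjnt A C \<and> disjnt A D \<and> disjnt B C \<and> disjnt B D \<and> disjnt C D \<and>
           f1 ` (ext_real - circle_topology closure_of A) = B \<and>
           f2 ` (ext_real - circle_topology closure_of C) = D))"


section \<open>Well-definedness\<close>

lemma moebius_map_mult:
  assumes "det A \<noteq> 0" "det B \<noteq> 0"
  shows "moebius_map (A ** B) = moebius_map A \<circ> moebius_map B"
proof
  fix z
  obtain a b c d where A: "A $ 1 $ 1 = a" "A $ 1 $ 2 = b" "A $ 2 $ 1 = c" "A $ 2 $ 2 = d" by blast
  obtain a' b' c' d' where B: "B $ 1 $ 1 = a'" "B $ 1 $ 2 = b'" "B $ 2 $ 1 = c'" "B $ 2 $ 2 = d'"
    by blast
  have dA: "a * d - b * c \<noteq> 0" and dB: "a' * d' - b' * c' \<noteq> 0"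
    using assms A B by (auto simp: det_2)
  have dB': "complex_of_real a' * of_real d' - of_real b' * of_real c' \<noteq> 0"
    using dB by (metis of_real_diff of_real_eq_0_iff of_real_mult)
  have e: "(A ** B) $ 1 $ 1 = a * a' + b * c'" "(A ** B) $ 1 $ 2 = a * b' + b * d'"
     "(A ** B) $ 2 $ 1 = c * a' + d * c'" "(A ** B) $ 2 $ 2 = c * b' + d * d'"
    using A B by (simp_all add: matrix_matrix_mult_def sum_2)
  show "moebius_map (A ** B) z = (moebius_map A \<circ> moebius_map B) z"
  proof (cases z)
    case None
    show ?thesis
    proof (cases "c' = 0")
      case True
      then have "a' \<noteq> 0" using dB by auto
      then show ?thesis using True None by (simp add: moebius_map_def moebius_def Let_def e A B)
    next
      case False
      have 1: "complex_of_real c * (of_real a' / of_real c') + of_real d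
          = (of_real c * of_real a' + of_real d * of_real c') / of_real c'"
        using False by (simp add: field_simps)
      have 2: "complex_of_real a * (of_real a' / of_real c') + of_real b
          = (of_real a * of_real a' + of_real b * of_real c') / of_real c'"
        using False by (simp add: field_simps)
      show ?thesis using False None
        unfolding moebius_map_def moebius_def Let_def e A B comp_def
        by (simp add: 1[simplified] 2[simplified])
    qed
  next
    case (Some w)
    let ?n = "complex_of_real a' * w + of_real b'"
    let ?m = "complex_of_real c' * w + of_real d'"
    have num: "complex_of_real (a * a' + b * c') * w + of_real (a * b' + b * d')
        = of_real a * ?n + of_real b * ?m"
      and den: "complex_of_real (c * a' + d * c') * w + of_real (c * b' + d * d')
        = of_real c * ?n + of_real d * ?m"
      by (simp_all add: algebra_simps)
    have L: "moebius_map (A ** B) (Some w) =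
      (if of_real c * ?n + of_real d * ?m = 0 then None
       else Some ((of_real a * ?n + of_real b * ?m) / (of_real c * ?n + of_real d * ?m)))"
      unfolding moebius_map_def moebius_def Let_def e option.case num den by (rule refl)
    have R: "moebius_map B (Some w) = (if ?m = 0 then None else Some (?n / ?m))"
      unfolding moebius_map_def moebius_def Let_def B option.case by (rule refl)
    show ?thesis
    proof (cases "?m = 0")
      case True
      have "?n \<noteq> 0"
      proof
        assume n: "?n = 0"
        have "complex_of_real a' * of_real d' - of_real b' * of_real c'
            = of_real a' * ?m - of_real c' * ?n" by (simp add: algebra_simps)
        also have "\<dots> = 0" unfolding n True by simp
        finally show False using dB' by simp
      qed
      then show ?thesis
        unfolding Some comp_def L R True by (simp add: moebius_map_def Let_def A)
    next
      case False
      have 1: "complex_of_real c * (?n / ?m) + of_real d = (of_real c * ?n + of_real d * ?m) / ?m"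
        using False by (simp add: field_simps)
      have 2: "complex_of_real a * (?n / ?m) + of_real b = (of_real a * ?n + of_real b * ?m) / ?m"
        using False by (simp add: field_simps)
      have "moebius_map A (Some (?n / ?m)) =
        (if (of_real c * ?n + of_real d * ?m) / ?m = 0 then None
         else Some ((of_real a * ?n + of_real b * ?m) / ?m / ((of_real c * ?n + of_real d * ?m) / ?m)))"
        unfolding moebius_map_def moebius_def Let_def A option.case 1 2 by (rule refl)
      then show ?thesis
        unfolding Some comp_def L R using False by simp
    qed
  qed
qed

lemma moebius_map_id: "moebius_map (mat 1) = id"
  by (auto simp: fun_eq_iff moebius_map_def moebius_def Let_def mat_def split: option.split)

lemma group_moebius: "group moebius_group"
proof (rule groupI)
  fix f g assume "f \<in> carrier moebius_group" "g \<in> carrier moebius_group"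
  then obtain A B where AB: "f = moebius_map A" "g = moebius_map B" "det A > 0" "det B > 0"
    by (auto simp: moebius_group_def)
  then have "f \<circ> g = moebius_map (A ** B)" "det (A ** B) > 0"
    by (simp_all add: moebius_map_mult det_mul)
  then show "f \<otimes>\<^bsub>moebius_group\<^esub> g \<in> carrier moebius_group"
    by (auto simp: moebius_group_def)
next
  show "\<one>\<^bsub>moebius_group\<^esub> \<in> carrier moebius_group"
    by (auto simp: moebius_group_def moebius_map_id[symmetric])
next
  fix f assume "f \<in> carrier moebius_group"
  then obtain A where A: "f = moebius_map A" "det A > 0"
    by (auto simp: moebius_group_def)
  then have "invertible A" by (simp add: invertible_det_nz)
  then obtain B where B: "B ** A = mat 1" by (auto simp: invertible_def)
  have "det B * det A = 1" by (metis B det_I det_mul)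
  then have "det B > 0" using A(2) by (metis zero_less_mult_pos2 zero_less_one)
  moreover have "moebius_map B \<circ> f = id"
    using A B \<open>det B > 0\<close> by (simp add: moebius_map_mult[symmetric] moebius_map_id)
  ultimately show "\<exists>h \<in> carrier moebius_group. h \<otimes>\<^bsub>moebius_group\<^esub> f = \<one>\<^bsub>moebius_group\<^esub>"
    by (auto simp: moebius_group_def)
qed (auto simp: moebius_group_def)

lemma moebius_map_eq_id:
  assumes "det A = 1" "moebius_map A = id"
  shows "A = mat 1 \<or> A = - mat 1"
proof -
  obtain a b c d where A: "A $ 1 $ 1 = a" "A $ 1 $ 2 = b" "A $ 2 $ 1 = c" "A $ 2 $ 2 = d" by blast
  have "moebius_map A None = None" "moebius_map A (Some 0) = Some 0" "moebius_map A (Some 1) = Some 1"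
    using assms(2) by simp_all
  then have "c = 0" "b = 0" "a = d"
    by (auto simp: moebius_map_def moebius_def Let_def A field_simps split: if_splits)
  moreover have "a * d - b * c = 1" using assms(1) A by (simp add: det_2)
  ultimately have "(a = 1 \<or> a = -1) \<and> b = 0 \<and> c = 0 \<and> d = a"
    by (auto simp: square_eq_1_iff)
  then show ?thesis using A by (auto simp: vec_eq_iff forall_2 mat_def)
qed

lemma moebius_map_scaleR:
  assumes "s \<noteq> 0"
  shows "moebius_map (s *\<^sub>R A) = moebius_map A"
proof
  fix z
  have "of_real (s * x) * w + of_real (s * y) = of_real s * (of_real x * w + of_real y)"
    for x y and w :: complex by (simp add: algebra_simps)
  then show "moebius_map (s *\<^sub>R A) z = moebius_map A z" using assms
    unfolding moebius_map_def moebius_def Let_def vector_scaleR_component real_scaleR_def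
    by (simp split: option.split)
qed

lemma moebius_map_eq_iff:
  assumes "det A = 1" "det B = 1"
  shows "moebius_map A = moebius_map B \<longleftrightarrow> A = B \<or> A = - B"
proof
  assume eq: "moebius_map A = moebius_map B"
  have "invertible B" using assms by (simp add: invertible_det_nz)
  then obtain C where C: "C ** B = mat 1" "B ** C = mat 1" by (auto simp: invertible_def)
  have dC: "det C = 1" by (metis C(1) assms(2) det_I det_mul mult.right_neutral)
  have "moebius_map (C ** A) = id"
    using assms dC eq C by (simp add: moebius_map_mult) (simp add: moebius_map_mult[symmetric] moebius_map_id)
  moreover have "det (C ** A) = 1" by (simp add: det_mul dC assms)
  ultimately have "C ** A = mat 1 \<or> C ** A = - mat 1" by (rule moebius_map_eq_id[rotated])
  moreover have "A = B ** (C ** A)" using C by (simp add: matrix_mul_assoc)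
  moreover have "B ** (- mat 1) = - B"
    by (simp add: vec_eq_iff matrix_matrix_mult_def mat_def forall_2 sum_2)
  ultimately show "A = B \<or> A = - B" by (metis matrix_mul_rid)
next
  have "moebius_map (- B) = moebius_map B"
    using moebius_map_scaleR[of "-1" B] by simp
  moreover assume "A = B \<or> A = - B"
  ultimately show "moebius_map A = moebius_map B" by auto
qed

lemma tr_moebius_map:
  assumes "det A = 1"
  shows "tr (moebius_map A) = \<bar>trace A\<bar>"
  unfolding tr_def
proof (rule the_equality)
  fix t assume "\<exists>B. det B = 1 \<and> moebius_map B = moebius_map A \<and> t = \<bar>trace B\<bar>"
  then obtain B where "B = A \<or> B = - A" "t = \<bar>trace B\<bar>"
    using moebius_map_eq_iff assms by blast
  then show "t = \<bar>trace A\<bar>" by (auto simp: trace_def sum_2)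
qed (use assms in blast)

lemma moebius_map_image_SL2: "moebius_map ` SL2 = carrier moebius_group"
proof
  show "moebius_map ` SL2 \<subseteq> carrier moebius_group"
    by (auto simp: SL2_def moebius_group_def)
  show "carrier moebius_group \<subseteq> moebius_map ` SL2"
  proof
    fix f assume "f \<in> carrier moebius_group"
    then obtain A where A: "f = moebius_map A" "det A > 0" by (auto simp: moebius_group_def)
    let ?r = "1 / sqrt (det A)"
    have r: "?r \<noteq> 0" "?r * ?r * det A = 1" using A(2) by auto
    have "det (s *\<^sub>R A) = s * s * det A" for s
      by (simp add: det_2 algebra_simps)
    then have "det (?r *\<^sub>R A) = 1" using r by simp
    moreover have "moebius_map (?r *\<^sub>R A) = moebius_map A"
      using r(1) by (rule moebius_map_scaleR)
    ultimately show "f \<in> moebius_map ` SL2"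
      unfolding SL2_def using A(1) by (intro image_eqI[of f moebius_map "?r *\<^sub>R A"]) simp_all
  qed
qed

lemma openin_moebius_topology:
  "openin moebius_topology U \<longleftrightarrow>
     U \<subseteq> carrier moebius_group \<and> openin (top_of_set SL2) {A \<in> SL2. moebius_map A \<in> U}"
proof -
  have "istopology (\<lambda>U. U \<subseteq> carrier moebius_group \<and>
     openin (top_of_set SL2) {A \<in> SL2. moebius_map A \<in> U})"
    unfolding istopology_def
  proof (rule conjI; intro allI impI conjI; (elim conjE)?)
    fix S T assume "openin (top_of_set SL2) {A \<in> SL2. moebius_map A \<in> S}"
      "openin (top_of_set SL2) {A \<in> SL2. moebius_map A \<in> T}"
    then have "openin (top_of_set SL2)
        ({A \<in> SL2. moebius_map A \<in> S} \<inter> {A \<in> SL2. moebius_map A \<in> T})"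
      by (rule openin_Int)
    moreover have "{A \<in> SL2. moebius_map A \<in> S \<inter> T}
        = {A \<in> SL2. moebius_map A \<in> S} \<inter> {A \<in> SL2. moebius_map A \<in> T}" by auto
    ultimately show "openin (top_of_set SL2) {A \<in> SL2. moebius_map A \<in> S \<inter> T}"
      by (simp only:)
  next
    fix K assume K: "\<forall>S\<in>K. S \<subseteq> carrier moebius_group \<and>
      openin (top_of_set SL2) {A \<in> SL2. moebius_map A \<in> S}"
    have "{A \<in> SL2. moebius_map A \<in> \<Union>K} = (\<Union>S\<in>K. {A \<in> SL2. moebius_map A \<in> S})" by auto
    moreover have "openin (top_of_set SL2) (\<Union>S\<in>K. {A \<in> SL2. moebius_map A \<in> S})"
      using K by (intro openin_Union) auto
    ultimately show "openin (top_of_set SL2) {A \<in> SL2. moebius_map A \<in> \<Union>K}"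
      by (simp only:)
  qed auto
  then show ?thesis by (simp add: moebius_topology_def)
qed

lemma topspace_moebius_topology: "topspace moebius_topology = carrier moebius_group"
proof -
  have "{A \<in> SL2. moebius_map A \<in> carrier moebius_group} = SL2"
    using moebius_map_image_SL2 by auto
  then have "openin moebius_topology (carrier moebius_group)"
    by (simp add: openin_moebius_topology)
  then show ?thesis
    by (meson openin_moebius_topology openin_subset openin_topspace subset_antisym)
qed

lemma quotient_map_moebius_map: "quotient_map (top_of_set SL2) moebius_topology moebius_map"
  unfolding quotient_map_def topspace_moebius_topology openin_moebius_topology topspace_euclidean_subtopology
  using moebius_map_image_SL2 by blast

end

theory Submission
  imports Defs
begin

text \<open>Moving the fixed point of $f$ to $\infty$ and the pole of $g$ to $0$, one may take
  $f(z) = z + t$ and $g(z) = T - 1/z$ with $t \neq 0$ and $|T| > 2$, so that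
  $\mathrm{tr}[f,g] = 2 + t^2$ and $f^n g$ is elliptic iff $|T + nt| < 2$; this is impossible for
  $n > 2|T|/|t|$. If no $f^n g$ is elliptic, every word has a matrix with an off-diagonal entry
  bounded away from zero, hence stays away from the identity; powers of an elliptic element, on the
  other hand, accumulate at the identity. If $tT > 0$, the interval between the attracting fixed
  points of $f$ and $g$ that does not contain $0$ is mapped strictly inside itself by both, so $f$ and $g$ are not
  antiparallel. If $tT < 0$, some $h = f^m g$ with $m \geq 0$ is the last before the traces jump
  across $(-2,2)$; $h$ pairs the isometric circles $|z| = 1$ and $|z - (T + mt)| = 1$, which fit
  into a strip of width $|t|$, so $f$ and $h$ generate a Schottky group.\<close>

section \<open>Fixed points and traces of real matrices\<close>

text \<open>Semidiscreteness concerns all words, while the hypothesis controls only the elements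
  \<open>f^n g\<close>. What bridges the gap is that in the normal form \<open>f^n g\<close> is z ->
  (T + n t) - 1/z, the same shape as \<open>g\<close> with another \<open>T\<close>. A word is
  therefore a continued fraction with partial quotients T + n_i t, up to translations at both ends,
  and its lower left matrix entries obey the recursion c_{k+1} = (T + n t) c_k - c_{k-1} with c_1 =
  1. Partial quotients of modulus at least 2 keep |c_k| from decreasing. The value 2 is attained
  when \<open>f^n g\<close> is parabolic, so exponential growth cannot be claimed; the non-strict
  bound |c_k| >= 1 is what remains in general, and it suffices. Words in \<open>f\<close> alone have
  c = 0 and are handled by their upper right entry n t instead.\<close>

definition mat2 :: "real \<Rightarrow> real \<Rightarrow> real \<Rightarrow> real \<Rightarrow> real^2^2" where
  "mat2 a b c d = vector [vector [a, b], vector [c, d]]"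

lemma mat2_nth [simp]:
  "mat2 a b c d $ 1 $ 1 = a" "mat2 a b c d $ 1 $ 2 = b"
  "mat2 a b c d $ 2 $ 1 = c" "mat2 a b c d $ 2 $ 2 = d"
  by (simp_all add: mat2_def)

lemma mat2_eta: "A = mat2 (A$1$1) (A$1$2) (A$2$1) (A$2$2)"
  by (simp add: vec_eq_iff forall_2)

lemma mat2_eq_iff [simp]:
  "mat2 a b c d = mat2 a' b' c' d' \<longleftrightarrow> a = a' \<and> b = b' \<and> c = c' \<and> d = d'"
  by (auto simp: vec_eq_iff forall_2)

lemma mat2_mult [simp]:
  "mat2 a b c d ** mat2 a' b' c' d' =
     mat2 (a * a' + b * c') (a * b' + b * d') (c * a' + d * c') (c * b' + d * d')"
  by (simp add: vec_eq_iff forall_2 matrix_matrix_mult_def sum_2)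

lemma det_mat2 [simp]: "det (mat2 a b c d) = a * d - b * c"
  by (simp add: det_2)

lemma trace_mat2 [simp]: "trace (mat2 a b c d) = a + d"
  by (simp add: trace_def sum_2)

lemma mat_1_eq_mat2: "mat 1 = mat2 1 0 0 1"
  by (simp add: vec_eq_iff forall_2 mat_def)

lemma mat2_uminus [simp]: "- mat2 a b c d = mat2 (- a) (- b) (- c) (- d)"
  by (simp add: vec_eq_iff forall_2)

lemma mat2_cases: obtains a b c d where "A = mat2 a b c d"
  using mat2_eta by blast

lemma moebius_map_mat2_None [simp]:
  "moebius_map (mat2 a b c d) None = (if c = 0 then None else Some (of_real (a / c)))"
  by (simp add: moebius_map_def)

lemma moebius_map_mat2_Some:
  "moebius_map (mat2 a b c d) (Some z) =
     (if of_real c * z + of_real d = 0 then None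
      else Some ((of_real a * z + of_real b) / (of_real c * z + of_real d)))"
  by (simp add: moebius_map_def moebius_def Let_def)

lemma moebius_map_mat2_real:
  "moebius_map (mat2 a b c d) (Some (of_real x)) =
     (if c * x + d = 0 then None else Some (of_real ((a * x + b) / (c * x + d))))"
proof -
  have "complex_of_real c * of_real x + of_real d = of_real (c * x + d)" by simp
  then have "complex_of_real c * of_real x + of_real d = 0 \<longleftrightarrow> c * x + d = 0"
    by (metis of_real_eq_0_iff)
  then show ?thesis by (simp add: moebius_map_mat2_Some)
qed

lemma moebius_map_uminus [simp]: "moebius_map (- A) = moebius_map A"
  using moebius_map_scaleR[of "-1" A] by simp

lemma det_uminus_2 [simp]: "det (- A :: real^2^2) = det A"
  by (simp add: det_2)

lemma ext_real_cases:
  assumes "p \<in> ext_real" obtains "p = None" | x where "p = Some (of_real x)"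
  using assms by (auto simp: ext_real_def Reals_def)

lemma ext_real_simps [simp]:
  "None \<in> ext_real" "Some z \<in> ext_real \<longleftrightarrow> z \<in> \<real>"
  by (auto simp: ext_real_def)

lemma half_plane_simps [simp]:
  "None \<notin> half_plane" "Some z \<in> half_plane \<longleftrightarrow> Im z > 0"
  by (auto simp: half_plane_def)

lemma moebius_map_ext_real:
  assumes "p \<in> ext_real" shows "moebius_map A p \<in> ext_real"
  using assms
  by (cases A rule: mat2_cases; cases p rule: ext_real_cases) (auto simp: moebius_map_mat2_real)

lemma moebius_map_half_plane:
  assumes "det A > 0" "p \<in> half_plane" shows "moebius_map A p \<in> half_plane"
proof -
  obtain a b c d where A: "A = mat2 a b c d" by (rule mat2_cases)
  obtain z where z: "p = Some z" "Im z > 0" using assms(2) by (auto simp: half_plane_def)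
  let ?w = "of_real c * z + of_real d"
  have ad: "a * d - b * c > 0" using assms(1) A by simp
  have nz: "?w \<noteq> 0"
  proof
    assume 0: "?w = 0"
    then have "Im ?w = 0" "Re ?w = 0" by (simp_all only: zero_complex.simps)
    then have "c = 0" "d = 0" using z(2) by auto
    then show False using ad by simp
  qed
  have "Im ((of_real a * z + of_real b) / ?w) = (a * d - b * c) * Im z / (cmod ?w)\<^sup>2"
    by (simp add: Im_divide cmod_power2 algebra_simps)
  also have "\<dots> > 0" using ad z(2) nz by simp
  finally show ?thesis using nz by (simp add: A z moebius_map_mat2_Some)
qed

lemma carrier_moebius_group_iff: "f \<in> carrier moebius_group \<longleftrightarrow> (\<exists>A. det A = 1 \<and> f = moebius_map A)"
  using moebius_map_image_SL2 by (auto simp: SL2_def)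

lemma moebius_map_in_carrier [simp]: "det A > 0 \<Longrightarrow> moebius_map A \<in> carrier moebius_group"
  by (auto simp: moebius_group_def)

lemma moebius_group_simps [simp]:
  "x \<otimes>\<^bsub>moebius_group\<^esub> y = x \<circ> y" "\<one>\<^bsub>moebius_group\<^esub> = id"
  by (simp_all add: moebius_group_def)

lemma moebius_map_inverse:
  assumes "P ** Q = mat 1" "det P \<noteq> 0"
  shows "moebius_map P (moebius_map Q z) = z"
proof -
  have "det Q \<noteq> 0" using assms by (metis det_I det_mul mult_zero_right zero_neq_one)
  then have "moebius_map P \<circ> moebius_map Q = id"
    using assms by (simp flip: moebius_map_mult add: moebius_map_id)
  then show ?thesis by (simp add: fun_eq_iff)
qed

lemma fixed_point_half_plane_iff:
  assumes "det A = 1" "A = mat2 a b c d" "Im z > 0"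
  shows "moebius_map A (Some z) = Some z \<longleftrightarrow>
    of_real c * z\<^sup>2 + of_real (d - a) * z - of_real b = 0"
proof -
  have "moebius_map A (Some z) \<in> half_plane"
    using assms by (intro moebius_map_half_plane) auto
  then have "of_real c * z + of_real d \<noteq> 0"
    using assms by (auto simp: moebius_map_mat2_Some split: if_splits)
  then show ?thesis
    using assms(2) by (auto simp: moebius_map_mat2_Some field_simps power2_eq_square)
qed

text \<open>The fixed points are the roots of a real quadratic with discriminant (a + d)^2 - 4. A
  negative discriminant means a pair of conjugate roots, exactly one of them in the half-plane.
  Uniqueness in the definition of \<open>elliptic\<close> is what excludes the identity.\<close>

lemma elliptic_moebius_map_iff:
  assumes "det A = 1"
  shows "elliptic (moebius_map A) \<longleftrightarrow> \<bar>trace A\<bar> < 2"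
proof -
  obtain a b c d where A: "A = mat2 a b c d" by (rule mat2_cases)
  have det: "a * d - b * c = 1" using assms A by simp
  note fp = fixed_point_half_plane_iff[OF assms A]
  have disc: "(d - a)\<^sup>2 + 4 * b * c = (a + d)\<^sup>2 - 4"
    using det by (simp add: power2_eq_square algebra_simps)
  have sq: "\<bar>a + d\<bar> < 2 \<longleftrightarrow> (a + d)\<^sup>2 < 4"
    using abs_le_square_iff[of 2 "a + d"] by auto
  show ?thesis
  proof
    assume "elliptic (moebius_map A)"
    then obtain p where p: "p \<in> half_plane" "moebius_map A p = p"
      and u: "\<forall>q. q \<in> half_plane \<and> moebius_map A q = q \<longrightarrow> q = p"
      unfolding elliptic_def Ex1_def by metis
    obtain z where z: "p = Some z" "Im z > 0" using p(1) by (auto simp: half_plane_def)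
    have eq: "of_real c * z\<^sup>2 + of_real (d - a) * z - of_real b = 0"
      using fp[OF z(2)] p(2) unfolding z(1) by (rule iffD1)
    have "c \<noteq> 0"
    proof
      assume c: "c = 0"
      then have e: "of_real (d - a) * z = of_real b" using eq by simp
      then have "Im (of_real (d - a) * z) = 0" by simp
      then have "d = a" using z(2) by simp
      then have "b = 0" using e by simp
      \<comment> \<open>With \<open>c = 0\<close> a nonreal fixed point forces the identity, which
        then also fixes the point \<open>z + \<i>\<close>.\<close>
      have "moebius_map A (Some (z + \<i>)) = Some (z + \<i>)"
        using fp[of "z + \<i>"] z(2) c \<open>d = a\<close> \<open>b = 0\<close> by simp
      then have "z + \<i> = z" using spec[OF u, of "Some (z + \<i>)"] z by simp
      then show False by simp
    qed
    obtain x y where xy: "z = Complex x y" by (cases z)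
    have y: "y > 0" using z xy by simp
    have im: "2 * c * x * y + (d - a) * y = 0" and re: "c * (x\<^sup>2 - y\<^sup>2) + (d - a) * x - b = 0"
      using arg_cong[OF eq, of Im] arg_cong[OF eq, of Re]
      by (simp_all add: xy power2_eq_square algebra_simps)
    have "(2 * c * x + (d - a)) * y = 0" using im by (simp add: algebra_simps)
    then have s: "d - a = - 2 * c * x" using y by simp
    have b: "b = - c * (x\<^sup>2 + y\<^sup>2)" using re unfolding s by (simp add: power2_eq_square algebra_simps)
    have "(a + d)\<^sup>2 - 4 = - 4 * c\<^sup>2 * y\<^sup>2"
      unfolding disc[symmetric] s b by (simp add: power2_eq_square algebra_simps)
    also have "\<dots> < 0" using \<open>c \<noteq> 0\<close> y by simp
    finally show "\<bar>trace A\<bar> < 2" using sq A by simp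
  next
    assume "\<bar>trace A\<bar> < 2"
    then have D: "(d - a)\<^sup>2 + 4 * b * c < 0" using sq A disc by simp
    have c: "c \<noteq> 0"
    proof
      assume "c = 0" then show False using D zero_le_power2[of "d - a"] by simp
    qed
    \<comment> \<open>The quadratic formula, split into real and imaginary part; \<bar>c\<bar> in
      the denominator selects the root in the upper half-plane.\<close>
    define y where "y = sqrt (- ((d - a)\<^sup>2 + 4 * b * c)) / (2 * \<bar>c\<bar>)"
    define x where "x = (a - d) / (2 * c)"
    have y: "y > 0" unfolding y_def using D c by simp
    have "(2 * c * y)\<^sup>2 = (sqrt (- ((d - a)\<^sup>2 + 4 * b * c)))\<^sup>2"
      unfolding y_def using c by (simp add: power_mult_distrib power_divide)
    also have "\<dots> = - ((d - a)\<^sup>2 + 4 * b * c)" using D by (intro real_sqrt_pow2) linarith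
    finally have y2: "(2 * c * y)\<^sup>2 = - ((d - a)\<^sup>2 + 4 * b * c)" .
    have x2: "2 * c * x = a - d" unfolding x_def using c by simp
    have quad: "of_real c * w\<^sup>2 + of_real (d - a) * w - of_real b =
        of_real c * ((w - Complex x y) * (w - Complex x (- y)))" for w
    proof -
      have "(w - Complex x y) * (w - Complex x (- y)) = w\<^sup>2 - of_real (2 * x) * w + of_real (x\<^sup>2 + y\<^sup>2)"
        by (simp add: complex_eq_iff power2_eq_square algebra_simps)
      from arg_cong[OF this, of "\<lambda>u. of_real c * u"]
      have e: "of_real c * ((w - Complex x y) * (w - Complex x (- y))) =
          of_real c * w\<^sup>2 - of_real (2 * c * x) * w + of_real (c * (x\<^sup>2 + y\<^sup>2))"
        by (simp add: ring_distribs mult_ac)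
      have "4 * c * (c * (x\<^sup>2 + y\<^sup>2)) = (2 * c * x)\<^sup>2 + (2 * c * y)\<^sup>2"
        by (simp add: power2_eq_square algebra_simps)
      also have "\<dots> = 4 * c * (- b)"
        unfolding x2 y2 by (simp add: power2_commute[of a d])
      finally have "c * (x\<^sup>2 + y\<^sup>2) = - b" using c by (metis mult_cancel_left mult_eq_0_iff zero_neq_numeral)
      then show ?thesis unfolding e x2 by (simp add: algebra_simps)
    qed
    have "moebius_map A (Some w) = Some w \<longleftrightarrow> w = Complex x y" if "Im w > 0" for w
      using fp[OF that] quad[of w] c that y by auto
    then have "\<exists>!p. p \<in> half_plane \<and> moebius_map A p = p"
      using y by (intro ex1I[of _ "Some (Complex x y)"]) (auto simp: half_plane_def)
    then show "elliptic (moebius_map A)" unfolding elliptic_def using assms by simp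
  qed
qed

text \<open>Two distinct real roots x and y of the fixed point equation turn its discriminant (a +
  d)^2 - 4 into c^2 (x - y)^2 > 0. If infinity is fixed, then \<open>c = 0\<close> and the
  discriminant is (d - a)^2.\<close>

lemma hyperbolic_moebius_map_imp:
  assumes "det A = 1" "hyperbolic (moebius_map A)"
  shows "\<bar>trace A\<bar> > 2"
proof -
  obtain a b c d where A: "A = mat2 a b c d" by (rule mat2_cases)
  have det: "a * d - b * c = 1" using assms A by simp
  have disc: "(d - a)\<^sup>2 + 4 * b * c = (a + d)\<^sup>2 - 4"
    using det by (simp add: power2_eq_square algebra_simps)
  have sq: "\<bar>a + d\<bar> > 2 \<longleftrightarrow> (a + d)\<^sup>2 > 4"
    using abs_le_square_iff[of "a + d" 2] by auto
  obtain p q where "p \<noteq> q" "{r \<in> ext_real. moebius_map A r = r} = {p, q}"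
    using assms(2) unfolding hyperbolic_def card_2_iff by blast
  then have pq: "p \<in> ext_real" "q \<in> ext_real" "moebius_map A p = p" "moebius_map A q = q" "p \<noteq> q"
    and pq': "\<And>r. r \<in> ext_real \<Longrightarrow> moebius_map A r = r \<Longrightarrow> r = p \<or> r = q"
    by blast+
  have root: "c * x\<^sup>2 + (d - a) * x - b = 0" if "moebius_map A (Some (of_real x)) = Some (of_real x)" for x
  proof -
    have "c * x + d \<noteq> 0 \<and> (a * x + b) / (c * x + d) = x"
      using that unfolding A moebius_map_mat2_real
      by (metis of_real_eq_iff option.distinct(1) option.inject)
    then have "a * x + b = x * (c * x + d)" by (simp add: divide_eq_eq)
    then show ?thesis by (simp add: power2_eq_square algebra_simps)
  qed
  show ?thesis
  proof (cases "c = 0")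
    case True
    have "a \<noteq> d"
    proof
      assume "a = d"
      obtain x where x: "moebius_map A (Some (of_real x)) = Some (of_real x)"
        using pq by (metis ext_real_cases)
      then have "b = 0" using root[OF x] True \<open>a = d\<close> by simp
      \<comment> \<open>A translation with a finite fixed point is the identity, and the three
        points 0, 1, 2 cannot all lie in {p, q}.\<close>
      then have "moebius_map A (Some (of_real y)) = Some (of_real y)" for y
        using det True \<open>a = d\<close> by (auto simp: A moebius_map_mat2_real)
      then have "Some (of_real y) = p \<or> Some (of_real y) = q" for y
        using pq' by simp
      from this[of 0] this[of 1] this[of 2] show False by auto
    qed
    then have "(a + d)\<^sup>2 - 4 > 0" unfolding disc[symmetric] using True by simp
    then show ?thesis using sq A by simp
  next
    case False
    then have "moebius_map A None \<noteq> None" by (simp add: A)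
    then obtain x y where xy: "p = Some (of_real x)" "q = Some (of_real y)"
      using pq by (metis ext_real_cases)
    have 1: "c * x\<^sup>2 + (d - a) * x - b = 0" "c * y\<^sup>2 + (d - a) * y - b = 0"
      using pq xy root by auto
    then have "(x - y) * (c * (x + y) + (d - a)) = 0"
      by (simp add: power2_eq_square algebra_simps)
    then have s: "d - a = - c * (x + y)" using pq xy by auto
    have b: "b = - c * x * y" using 1(1) unfolding s by (simp add: power2_eq_square algebra_simps)
    have "(a + d)\<^sup>2 - 4 = c\<^sup>2 * (x - y)\<^sup>2"
      unfolding disc[symmetric] s b by (simp add: power2_eq_square algebra_simps)
    also have "\<dots> > 0" using False pq xy by auto
    finally show ?thesis using sq A by simp
  qed
qed

section \<open>Topology of the sphere and the circle\<close>

text \<open>Compact sets of complex numbers are the closed bounded ones, so neighbourhoods of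
  \<open>None\<close> are described by the filter \<open>at_infinity\<close>. Continuity at infinity
  and at poles thereby becomes a matter of filter limits.\<close>

lemma openin_sphere_iff:
  "openin sphere_topology U \<longleftrightarrow>
     open {z. Some z \<in> U} \<and> (None \<in> U \<longrightarrow> eventually (\<lambda>z. Some z \<in> U) at_infinity)"
  (is "?L \<longleftrightarrow> ?R")
proof
  assume ?L
  then consider V where "open V" "U = Some ` V"
    | C where "compact C" "closed C" "U = insert None (Some ` (- C))"
    unfolding sphere_topology_def openin_Alexandroff_compactification
    by (auto simp: Compl_eq_Diff_UNIV)
  then show ?R
  proof cases
    case 1
    then have "{z. Some z \<in> U} = V" by auto
    then show ?thesis using 1 by auto
  next
    case 2
    then have e: "Some z \<in> U \<longleftrightarrow> z \<notin> C" for z by auto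
    then have e': "{z. Some z \<in> U} = - C" by auto
    obtain B where "\<forall>z\<in>C. norm z \<le> B" using compact_imp_bounded[OF 2(1)] bounded_iff by metis
    then have "\<forall>z. norm z \<ge> B + 1 \<longrightarrow> z \<notin> C" by force
    then have "eventually (\<lambda>z. z \<notin> C) at_infinity" unfolding eventually_at_infinity by blast
    then show ?thesis using 2 e e' by (auto simp: open_Compl)
  qed
next
  assume R: ?R
  show ?L
  proof (cases "None \<in> U")
    case False
    have "U = Some ` {z. Some z \<in> U}"
    proof (rule Set.set_eqI)
      fix p show "p \<in> U \<longleftrightarrow> p \<in> Some ` {z. Some z \<in> U}"
        using False by (cases p) auto
    qed
    then show ?thesis unfolding sphere_topology_def
      using R openin_Alexandroff_compactification_image_Some by (metis open_openin)
  next
    case True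
    let ?C = "{z. Some z \<notin> U}"
    have e: "?C = - {z. Some z \<in> U}" by auto
    then have "closed ?C" using R by (simp add: closed_def)
    moreover obtain B where "\<forall>z. norm z \<ge> B \<longrightarrow> Some z \<in> U"
      using R True unfolding eventually_at_infinity by blast
    then have "\<forall>z\<in>?C. norm z \<le> B" by (metis linear mem_Collect_eq)
    then have "bounded ?C" using bounded_iff by blast
    ultimately have "compactin euclidean ?C" "closedin euclidean ?C"
      by (simp_all add: compact_eq_bounded_closed)
    moreover have "U = insert None (Some ` (topspace euclidean - ?C))"
    proof (rule Set.set_eqI)
      fix p show "p \<in> U \<longleftrightarrow> p \<in> insert None (Some ` (topspace euclidean - ?C))"
        using True by (cases p) auto
    qed
    ultimately show ?thesis unfolding sphere_topology_def openin_Alexandroff_compactification by blast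
  qed
qed

lemma topspace_sphere_topology [simp]: "topspace sphere_topology = UNIV"
  by (simp add: sphere_topology_def UNIV_option_conv)

lemma topspace_circle_topology [simp]: "topspace circle_topology = ext_real"
  by (simp add: circle_topology_def)

lemma openin_circle_iff:
  "openin circle_topology U \<longleftrightarrow> U \<subseteq> ext_real \<and>
     open {x::real. Some (of_real x) \<in> U} \<and>
     (None \<in> U \<longrightarrow> eventually (\<lambda>x::real. Some (of_real x) \<in> U) at_infinity)"
  (is "?L \<longleftrightarrow> ?R")
proof
  assume ?L
  then obtain V where V: "openin sphere_topology V" "U = V \<inter> ext_real"
    unfolding circle_topology_def openin_subtopology by blast
  have e: "Some (of_real x) \<in> U \<longleftrightarrow> Some (of_real x) \<in> V" for x using V by simp
  have "open (of_real -` {z. Some z \<in> V} :: real set)"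
    using V(1) unfolding openin_sphere_iff by (intro open_vimage) (auto intro!: continuous_intros)
  moreover have "eventually (\<lambda>x::real. Some (of_real x) \<in> V) at_infinity" if N: "None \<in> U"
  proof -
    obtain R where "\<forall>z. norm z \<ge> R \<longrightarrow> Some z \<in> V"
      using V N unfolding openin_sphere_iff eventually_at_infinity by blast
    then show ?thesis unfolding eventually_at_infinity by (metis norm_of_real real_norm_def)
  qed
  ultimately show ?R using V by (auto simp: vimage_def)
next
  assume R: ?R
  let ?V0 = "{x::real. Some (of_real x) \<in> U}"
  have op: "open {z. Re z \<in> ?V0}"
    using R open_vimage[of ?V0 Re] continuous_on_Re[OF continuous_on_id, of UNIV] by (simp add: vimage_def)
  obtain r where r: "None \<in> U \<Longrightarrow> \<forall>x::real. norm x \<ge> r \<longrightarrow> Some (of_real x) \<in> U"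
    using R unfolding eventually_at_infinity by blast
  \<comment> \<open>An open set of the sphere that cuts out \<open>U\<close> on the circle: the
    vertical strips over the finite part of \<open>U\<close>, together with the outside of a disc if
    \<open>U\<close> contains infinity. By the choice of \<open>r\<close> the latter adds no new
    real points.\<close>
  define V where "V = {z. Re z \<in> ?V0} \<union> (if None \<in> U then {z. norm z > r} else {})"
  have "open V" unfolding V_def using op
    by (auto intro!: open_Un open_Collect_less continuous_intros)
  moreover have "eventually (\<lambda>z. z \<in> V) at_infinity" if "None \<in> U"
    unfolding V_def eventually_at_infinity using that by (intro exI[of _ "r + 1"]) auto
  ultimately have "openin sphere_topology (Some ` V \<union> (U \<inter> {None}))"
    unfolding openin_sphere_iff by (auto simp: image_iff)
  moreover have "U = (Some ` V \<union> (U \<inter> {None})) \<inter> ext_real"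
  proof (intro equalityI subsetI)
    fix p assume p: "p \<in> U"
    then have "p \<in> ext_real" using R by blast
    then show "p \<in> (Some ` V \<union> (U \<inter> {None})) \<inter> ext_real"
      using p by (cases p rule: ext_real_cases) (auto simp: V_def)
  next
    fix p assume p: "p \<in> (Some ` V \<union> (U \<inter> {None})) \<inter> ext_real"
    then have "p \<in> ext_real" by blast
    then show "p \<in> U" using p r
      by (cases p rule: ext_real_cases) (auto simp: V_def split: if_splits)
  qed
  ultimately show ?L unfolding circle_topology_def openin_subtopology by blast
qed

section \<open>Moebius transformations as homeomorphisms of the sphere and the circle\<close>

lemma moebius_map_eventually_at:
  assumes A: "det A \<noteq> 0" and U: "openin sphere_topology U" "moebius_map A (Some z) \<in> U"
  shows "eventually (\<lambda>w. moebius_map A (Some w) \<in> U) (nhds z)"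
proof -
  obtain a b c d where abcd: "A = mat2 a b c d" by (rule mat2_cases)
  let ?n = "\<lambda>w. of_real a * w + of_real b :: complex"
  let ?d = "\<lambda>w. of_real c * w + of_real d :: complex"
  show ?thesis
  proof (cases "?d z = 0")
    case False
    have op: "open {w. Some w \<in> U}" using U(1) by (simp add: openin_sphere_iff)
    have "isCont (\<lambda>w. ?n w / ?d w) z" using False by (intro continuous_intros) auto
    then have "((\<lambda>w. ?n w / ?d w) \<longlongrightarrow> ?n z / ?d z) (nhds z)"
      by (simp add: isCont_def tendsto_nhds_iff)
    then have 1: "eventually (\<lambda>w. ?n w / ?d w \<in> {w. Some w \<in> U}) (nhds z)"
      by (rule topological_tendstoD[OF _ op])
        (use U(2) False in \<open>simp add: abcd moebius_map_mat2_Some\<close>)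
    have "isCont ?d z" by (intro continuous_intros)
    then have "(?d \<longlongrightarrow> ?d z) (nhds z)"
      by (simp add: isCont_def tendsto_nhds_iff)
    then have "eventually (\<lambda>w. ?d w \<noteq> 0) (nhds z)"
      using False by (rule tendsto_imp_eventually_ne)
    with 1 show ?thesis
      by eventually_elim (simp add: abcd moebius_map_mat2_Some)
  next
    case True
    then have "None \<in> U" using U(2) by (simp add: abcd moebius_map_mat2_Some)
    then have inf: "eventually (\<lambda>w. Some w \<in> U) at_infinity" using U(1) by (simp add: openin_sphere_iff)
    have det: "a * d - b * c \<noteq> 0" using A abcd by simp
    have c: "c \<noteq> 0" using True det by auto
    \<comment> \<open>The determinant is a combination of numerator and denominator, so they cannot
      both vanish at \<open>z\<close>; hence the quotient tends to infinity at the pole.\<close>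
    have nz: "?n z \<noteq> 0"
    proof
      assume 0: "?n z = 0"
      have "of_real (a * d - b * c) = of_real a * ?d z - of_real c * ?n z" by (simp add: algebra_simps)
      then have "of_real (a * d - b * c) = (0::complex)" unfolding 0 True by simp
      then show False using det by (simp only: of_real_eq_0_iff)
    qed
    have "filterlim ?d (at 0) (at z)"
    proof (rule filterlim_atI)
      have "isCont ?d z" by (intro continuous_intros)
      then show "(?d \<longlongrightarrow> 0) (at z)" using True by (simp add: continuous_at)
      show "\<forall>\<^sub>F w in at z. ?d w \<noteq> 0"
      proof (rule eventually_at_filter[THEN iffD2, OF always_eventually], intro allI impI notI)
        fix w assume "w \<noteq> z" "?d w = 0"
        moreover have "of_real c * (w - z) = ?d w - ?d z" by (simp add: algebra_simps)
        ultimately have "of_real c * (w - z) = 0" using True by (simp only: diff_self)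
        then show False using c \<open>w \<noteq> z\<close> by simp
      qed
    qed
    moreover have "(?n \<longlongrightarrow> ?n z) (at z)" by (intro tendsto_intros)
    ultimately have "filterlim (\<lambda>w. ?n w / ?d w) at_infinity (at z)"
      using nz by (intro filterlim_divide_at_infinity)
    then have "eventually (\<lambda>w. Some (?n w / ?d w) \<in> U) (at z)"
      using inf unfolding filterlim_iff by blast
    then have "eventually (\<lambda>w. moebius_map A (Some w) \<in> U) (at z)"
      by eventually_elim (use \<open>None \<in> U\<close> in \<open>simp add: abcd moebius_map_mat2_Some\<close>)
    then show ?thesis using U(2) unfolding eventually_nhds_conv_at by blast
  qed
qed

text \<open>Precomposition with the inversion w -> 1/w moves infinity to 0, where continuity is
  already known. The inversion has determinant -1, which is why the continuity lemmas ask for a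
  nonzero determinant instead of a positive one.\<close>

lemma moebius_map_eventually_at_infinity:
  assumes A: "det A \<noteq> 0" and U: "openin sphere_topology U" "moebius_map A None \<in> U"
  shows "eventually (\<lambda>w. moebius_map A (Some w) \<in> U) at_infinity"
proof -
  have J: "det (mat2 0 1 1 0) \<noteq> 0" by simp
  have "moebius_map (A ** mat2 0 1 1 0) (Some 0) \<in> U"
    using U(2) by (simp add: moebius_map_mult[OF A J] moebius_map_mat2_Some)
  then have "eventually (\<lambda>w. moebius_map (A ** mat2 0 1 1 0) (Some w) \<in> U) (nhds 0)"
    using A U(1) by (intro moebius_map_eventually_at) (simp_all add: det_mul)
  then have "eventually (\<lambda>w. moebius_map (A ** mat2 0 1 1 0) (Some w) \<in> U) (at 0)"
    by (simp add: eventually_nhds_conv_at)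
  then have "eventually (\<lambda>w. moebius_map (A ** mat2 0 1 1 0) (Some (inverse w)) \<in> U) at_infinity"
    by (simp add: at_to_infinity eventually_filtermap)
  moreover have "eventually (\<lambda>w::complex. w \<noteq> 0) at_infinity"
    unfolding eventually_at_infinity by (intro exI[of _ 1]) auto
  ultimately show ?thesis
    by eventually_elim (simp add: moebius_map_mult[OF A J] moebius_map_mat2_Some divide_inverse)
qed

lemma continuous_map_moebius_map:
  assumes "det A \<noteq> 0"
  shows "continuous_map sphere_topology sphere_topology (moebius_map A)"
  unfolding continuous_map_def
proof (intro conjI allI impI)
  fix U assume U: "openin sphere_topology U"
  have "\<exists>T. open T \<and> z \<in> T \<and> T \<subseteq> {z. moebius_map A (Some z) \<in> U}"
    if "moebius_map A (Some z) \<in> U" for z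
    using moebius_map_eventually_at[OF assms U that] unfolding eventually_nhds by blast
  then have "open {z. moebius_map A (Some z) \<in> U}"
    by (subst open_subopen) blast
  then show "openin sphere_topology {x \<in> topspace sphere_topology. moebius_map A x \<in> U}"
    using moebius_map_eventually_at_infinity[OF assms U] by (simp add: openin_sphere_iff)
qed auto

lemma homeomorphic_map_moebius_map_circle:
  assumes "P ** Q = mat 1"
  shows "homeomorphic_map circle_topology circle_topology (moebius_map P)"
proof -
  have QP: "Q ** P = mat 1" using assms matrix_left_right_inverse by blast
  have d: "det P \<noteq> 0" "det Q \<noteq> 0"
    using arg_cong[OF assms, of det] by (auto simp: det_mul)
  have "homeomorphic_maps sphere_topology sphere_topology (moebius_map P) (moebius_map Q)"
    unfolding homeomorphic_maps_def
    using d assms QP by (auto simp: continuous_map_moebius_map moebius_map_inverse)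
  then have "homeomorphic_maps circle_topology circle_topology (moebius_map P) (moebius_map Q)"
    unfolding circle_topology_def
    by (rule homeomorphic_maps_subtopologies_alt) (auto intro: moebius_map_ext_real)
  then show ?thesis using homeomorphic_map_maps by blast
qed

section \<open>Separation, closures and intervals\<close>

lemma Hausdorff_space_sphere: "Hausdorff_space sphere_topology"
  unfolding sphere_topology_def
  by (simp add: Hausdorff_space_Alexandroff_compactification locally_compact_space_euclidean Hausdorff_space_euclidean)

text \<open>Every neighbourhood of infinity contains all reals of large modulus, so infinity joins
  the closure exactly when \<open>I\<close> is unbounded. The bounded case serves the isometric
  intervals, the unbounded case the half-lines with end point infinity.\<close>

lemma closure_of_circle:
  fixes I :: "real set"
  shows "circle_topology closure_of (Some ` of_real ` I) =
    Some ` of_real ` closure I \<union> (if bounded I then {} else {None})"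
proof (rule Set.set_eqI)
  fix p
  show "p \<in> circle_topology closure_of (Some ` of_real ` I) \<longleftrightarrow>
    p \<in> Some ` of_real ` closure I \<union> (if bounded I then {} else {None})"
  proof (cases "p \<in> ext_real")
    case False
    then show ?thesis by (auto simp: in_closure_of)
  next
    case True
    then show ?thesis
    proof (cases p rule: ext_real_cases)
      case 1
      have "p \<in> circle_topology closure_of (Some ` of_real ` I) \<longleftrightarrow> \<not> bounded I"
      proof
        assume L: "p \<in> circle_topology closure_of (Some ` of_real ` I)"
        show "\<not> bounded I"
        proof
          assume "bounded I"
          then have b: "bounded (closure I)" by (rule bounded_closure)
          let ?U = "insert None (Some ` complex_of_real ` (- closure I))"
          have e: "{x. Some (of_real x) \<in> ?U} = - closure I" by (auto simp: image_iff)
          obtain B where "\<forall>x\<in>closure I. norm x \<le> B" using b bounded_iff by metis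
          then have "\<forall>x. norm x \<ge> B + 1 \<longrightarrow> x \<notin> closure I" by force
          then have "eventually (\<lambda>x. x \<notin> closure I) at_infinity"
            unfolding eventually_at_infinity by blast
          then have "openin circle_topology ?U"
            unfolding openin_circle_iff e by (auto simp: image_iff)
          then have "\<exists>q. q \<in> Some ` complex_of_real ` I \<and> q \<in> ?U"
            using L[unfolded in_closure_of, THEN conjunct2, rule_format, of ?U] unfolding 1 by simp
          then show False using closure_subset[of I] by auto
        qed
      next
        assume nb: "\<not> bounded I"
        show "p \<in> circle_topology closure_of (Some ` of_real ` I)"
          unfolding in_closure_of
        proof (intro conjI allI impI)
          fix T assume "p \<in> T \<and> openin circle_topology T"
          then obtain B where B: "\<forall>x::real. norm x \<ge> B \<longrightarrow> Some (of_real x) \<in> T"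
            unfolding openin_circle_iff eventually_at_infinity using 1 by blast
          obtain x where "x \<in> I" "norm x > B"
            using nb unfolding bounded_iff by (meson not_less)
          then have "Some (of_real x) \<in> Some ` of_real ` I \<and> Some (of_real x) \<in> T" using B by auto
          then show "\<exists>q. q \<in> Some ` of_real ` I \<and> q \<in> T" by blast
        qed (use True in simp)
      qed
      then show ?thesis using 1 by auto
    next
      case (2 x)
      have "p \<in> circle_topology closure_of (Some ` of_real ` I) \<longleftrightarrow> x \<in> closure I"
      proof
        assume L: "p \<in> circle_topology closure_of (Some ` of_real ` I)"
        show "x \<in> closure I"
        proof (rule ccontr)
          assume x: "x \<notin> closure I"
          let ?U = "Some ` complex_of_real ` (- closure I)"
          have e: "{x. Some (of_real x) \<in> ?U} = - closure I" by (auto simp: image_iff)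
          have "openin circle_topology ?U"
            unfolding openin_circle_iff e by (auto simp: image_iff)
          then have "\<exists>q. q \<in> Some ` complex_of_real ` I \<and> q \<in> ?U"
            using L[unfolded in_closure_of, THEN conjunct2, rule_format, of ?U] x unfolding 2 by simp
          then show False using closure_subset[of I] by auto
        qed
      next
        assume x: "x \<in> closure I"
        show "p \<in> circle_topology closure_of (Some ` of_real ` I)"
          unfolding in_closure_of
        proof (intro conjI allI impI)
          fix T assume "p \<in> T \<and> openin circle_topology T"
          then have "open {x::real. Some (of_real x) \<in> T}" "x \<in> {x::real. Some (of_real x) \<in> T}"
            unfolding openin_circle_iff using 2 by auto
          then obtain y where "y \<in> I" "y \<in> {x::real. Some (of_real x) \<in> T}"
            using x by (metis closure_iff_nhds_not_empty disjoint_iff order_refl)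
          then show "\<exists>q. q \<in> Some ` of_real ` I \<and> q \<in> T" by auto
        qed (use True in simp)
      qed
      then show ?thesis using 2 by auto
    qed
  qed
qed

lemma connectedin_circle:
  fixes I :: "real set"
  assumes "connected I" shows "connectedin circle_topology (Some ` of_real ` I)"
proof -
  have "continuous_map euclideanreal circle_topology (\<lambda>x. Some (of_real x))"
    unfolding continuous_map_def openin_circle_iff by (auto simp: openin_circle_iff)
  then have "connectedin circle_topology ((\<lambda>x. Some (of_real x)) ` I)"
    by (rule connectedin_continuous_map_image) (rule connectedin_iff_connected[THEN iffD2, OF assms])
  then show ?thesis by (simp add: image_image)
qed

lemma open_interval_real:
  fixes I :: "real set"
  assumes "open I" "connected I" "I \<noteq> {}"
  shows "open_interval (Some ` of_real ` I)"
proof -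
  have e: "{x. Some (of_real x) \<in> Some ` of_real ` I} = I" by auto
  have "openin circle_topology (Some ` of_real ` I)"
    unfolding openin_circle_iff e using assms by auto
  moreover have "None \<in> ext_real" by simp
  then have "Some ` of_real ` I \<noteq> ext_real" by auto
  ultimately show ?thesis
    unfolding open_interval_def using assms connectedin_circle by auto
qed

lemma open_interval_moebius_map:
  assumes "P ** Q = mat 1" "open_interval J"
  shows "open_interval (moebius_map P ` J)"
proof -
  note h = homeomorphic_map_moebius_map_circle[OF assms(1)]
  have inj: "inj_on (moebius_map P) ext_real" "moebius_map P ` ext_real = ext_real"
    using homeomorphic_imp_injective_map[OF h] homeomorphic_imp_surjective_map[OF h] by simp_all
  have J: "openin circle_topology J" "connectedin circle_topology J" "J \<noteq> {}" "J \<noteq> ext_real"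
    using assms(2) by (auto simp: open_interval_def)
  have sub: "J \<subseteq> ext_real" using openin_subset[OF J(1)] by simp
  have "openin circle_topology (moebius_map P ` J)"
    using J(1) homeomorphic_map_openness_eq[OF h] by blast
  moreover have "connectedin circle_topology (moebius_map P ` J)"
    using J(2) homeomorphic_map_connectedness_eq[OF h] by blast
  moreover have "moebius_map P ` J \<noteq> ext_real"
    using inj sub J(4) by (metis inj_on_image_eq_iff order_refl)
  ultimately show ?thesis unfolding open_interval_def using J by auto
qed

lemma closed_interval_moebius_map:
  assumes "P ** Q = mat 1" "closed_interval J"
  shows "closed_interval (moebius_map P ` J)" "end_points (moebius_map P ` J) = moebius_map P ` end_points J"
proof -
  note h = homeomorphic_map_moebius_map_circle[OF assms(1)]
  have inj: "inj_on (moebius_map P) ext_real" "moebius_map P ` ext_real = ext_real"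
    using homeomorphic_imp_injective_map[OF h] homeomorphic_imp_surjective_map[OF h] by simp_all
  have J: "closedin circle_topology J" "connectedin circle_topology J" "J \<noteq> {}"
     "\<not> is_singleton J" "J \<noteq> ext_real"
    using assms(2) by (auto simp: closed_interval_def)
  have sub: "J \<subseteq> ext_real" using closedin_subset[OF J(1)] by simp
  have "closedin circle_topology (moebius_map P ` J)"
    using J(1) homeomorphic_map_closedness_eq[OF h] by blast
  moreover have "connectedin circle_topology (moebius_map P ` J)"
    using J(2) homeomorphic_map_connectedness_eq[OF h] by blast
  moreover have "moebius_map P ` J \<noteq> ext_real"
    using inj sub J(5) by (metis inj_on_image_eq_iff order_refl)
  moreover have "\<not> is_singleton (moebius_map P ` J)"
    using J(4) inj sub by (metis bij_betw_imageI bij_betw_same_card inj_on_subset is_singleton_altdef)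
  ultimately show "closed_interval (moebius_map P ` J)"
    unfolding closed_interval_def using J by auto
  show "end_points (moebius_map P ` J) = moebius_map P ` end_points J"
    unfolding end_points_def using sub homeomorphic_map_frontier_of[OF h] by simp
qed

lemma not_bounded_ray:
  fixes l :: real
  shows "\<not> bounded {l<..}" "\<not> bounded {..<l}"
proof -
  have "max (l + 1) (B + 1) \<in> {l<..} \<and> norm (max (l + 1) (B + 1)) > B" for B by auto
  then show "\<not> bounded {l<..}" unfolding bounded_iff by (meson not_less)
  have "min (l - 1) (- B - 1) \<in> {..<l} \<and> norm (min (l - 1) (- B - 1)) > B" for B by auto
  then show "\<not> bounded {..<l}" unfolding bounded_iff by (meson not_less)
qed

text \<open>The arc between a real number and infinity, in either direction, because the signs in
  the normal form decide which one is needed. The opposite ray \<open>K\<close> is the complement of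
  the arc, so the end points are the common points of \<open>J\<close> and the closure of
  \<open>K\<close>.\<close>

lemma closed_interval_ray:
  fixes I K :: "real set" and l :: real
  assumes "I = {l<..} \<and> K = {..<l} \<or> I = {..<l} \<and> K = {l<..}"
  defines "J \<equiv> insert None (Some ` complex_of_real ` insert l I)"
  shows "closed_interval J" "end_points J = {None, Some (of_real l)}"
proof -
  have I: "connected I" "closure I = insert l I" "\<not> bounded I" "l \<notin> I"
    and K: "closure K = insert l K" "\<not> bounded K" "K = UNIV - insert l I"
    using assms(1) not_bounded_ray by auto
  have "K \<noteq> {}" using K(2) by auto
  have clI: "circle_topology closure_of (Some ` of_real ` I) = J"
    and clK: "circle_topology closure_of (Some ` of_real ` K) = insert None (Some ` of_real ` insert l K)"
    unfolding closure_of_circle I(2) K(1) J_def using I(3) K(2) by (simp_all add: insert_commute)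
  have cJ: "closedin circle_topology J" "connectedin circle_topology J"
    unfolding clI[symmetric] using connectedin_closure_of[OF connectedin_circle[OF I(1)]] by simp_all
  have JK: "ext_real - J = Some ` of_real ` K"
    unfolding K(3) J_def by (auto simp: Reals_def ext_real_def)
  have "None \<in> J" "Some (of_real l) \<in> J" by (auto simp: J_def)
  then have "\<not> is_singleton J" by (metis is_singleton_def option.distinct(1) singletonD)
  moreover have "J \<noteq> ext_real" using JK \<open>K \<noteq> {}\<close> by auto
  ultimately show "closed_interval J"
    unfolding closed_interval_def using cJ \<open>None \<in> J\<close> by auto
  have "end_points J = circle_topology closure_of J \<inter> circle_topology closure_of (ext_real - J)"
    unfolding end_points_def frontier_of_closures by simp
  also have "\<dots> = J \<inter> insert None (Some ` of_real ` insert l K)"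
    unfolding JK clK using cJ(1) by (simp add: closure_of_closedin)
  also have "\<dots> = {None, Some (of_real l)}"
    unfolding J_def K(3) by auto
  finally show "end_points J = {None, Some (of_real l)}" .
qed

section \<open>Words in the normal form\<close>

abbreviation transl :: "real \<Rightarrow> real^2^2" where
  "transl t \<equiv> mat2 1 t 0 1"

text \<open>The matrix of z -> T - 1/z, of trace \<open>T\<close>, with pole 0 and isometric circle
  |z| = 1. Left multiplication by a translation only changes \<open>T\<close>.\<close>

abbreviation refl_transl :: "real \<Rightarrow> real^2^2" where
  "refl_transl T \<equiv> mat2 T (- 1) 1 0"

lemma matrix_mult_uminus_2:
  fixes A B :: "real^2^2"
  shows "A ** (- B) = - (A ** B)" "(- A) ** B = - (A ** B)"
  by (simp_all add: vec_eq_iff forall_2 matrix_matrix_mult_def sum_2)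

text \<open>Computations are made with the matrices of the normal form; \<open>cj\<close> carries
  them to the actual transformations, and \<open>moebius_map P\<close> carries points and intervals.
  The determinant of \<open>P\<close> is only positive, not 1, because the normalisation of
  \<open>g\<close> includes a rescaling.\<close>

locale moebius_conjugation =
  fixes P Q :: "real^2^2"
  assumes PQ: "P ** Q = mat 1" and det_P: "det P > 0"
begin

definition cj :: "real^2^2 \<Rightarrow> complex option \<Rightarrow> complex option" where
  "cj A = moebius_map (P ** A ** Q)"

lemma QP: "Q ** P = mat 1"
  using PQ matrix_left_right_inverse by blast

lemma det_P_Q: "det P * det Q = 1"
  using arg_cong[OF PQ, of det] by (simp add: det_mul)

lemma det_Q: "det Q > 0"
  using det_P_Q det_P by (metis zero_less_mult_pos zero_less_one)

lemma det_cj: "det (P ** A ** Q) = det A"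
  using det_P_Q by (simp add: det_mul)

lemma trace_cj: "trace (P ** A ** Q) = trace A"
proof -
  have "trace (P ** A ** Q) = trace (Q ** (P ** A))" by (rule trace_mul_sym)
  also have "Q ** (P ** A) = A" by (simp add: matrix_mul_assoc QP)
  finally show ?thesis .
qed

lemma map_P_Q [simp]: "moebius_map P (moebius_map Q z) = z"
  using moebius_map_inverse[OF PQ] det_P by simp

lemma map_Q_P [simp]: "moebius_map Q (moebius_map P z) = z"
  using moebius_map_inverse[OF QP] det_Q by simp

lemma map_P_eq_iff [simp]: "moebius_map P z = moebius_map P w \<longleftrightarrow> z = w"
  by (metis map_Q_P)

lemma map_P_ext_real_iff [simp]: "moebius_map P z \<in> ext_real \<longleftrightarrow> z \<in> ext_real"
  by (metis map_Q_P moebius_map_ext_real)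

lemma cj_carrier [simp]: "det A > 0 \<Longrightarrow> cj A \<in> carrier moebius_group"
  unfolding cj_def by (simp add: det_cj)

lemma cj_comp:
  assumes "det A \<noteq> 0" "det B \<noteq> 0"
  shows "cj A \<circ> cj B = cj (A ** B)"
proof -
  have "P ** A ** Q ** (P ** B ** Q) = P ** A ** (Q ** P) ** B ** Q"
    by (simp add: matrix_mul_assoc)
  also have "\<dots> = P ** (A ** B) ** Q" by (simp add: QP matrix_mul_assoc)
  finally show ?thesis
    unfolding cj_def using assms by (simp flip: moebius_map_mult add: det_cj)
qed

lemma cj_apply:
  assumes "det A \<noteq> 0"
  shows "cj A (moebius_map P z) = moebius_map P (moebius_map A z)"
proof -
  have "P ** A ** Q ** P = P ** A"
    by (simp add: QP flip: matrix_mul_assoc)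
  then have "cj A \<circ> moebius_map P = moebius_map P \<circ> moebius_map A"
    unfolding cj_def using assms det_P by (simp flip: moebius_map_mult add: det_cj)
  then show ?thesis by (simp add: fun_eq_iff)
qed

lemma cj_image: "det A \<noteq> 0 \<Longrightarrow> cj A ` moebius_map P ` X = moebius_map P ` moebius_map A ` X"
  by (simp add: image_image cj_apply)

lemma cj_mat_1: "cj (mat 1) = id"
  by (simp add: cj_def PQ moebius_map_id)

lemma tr_cj: "det A = 1 \<Longrightarrow> tr (cj A) = \<bar>trace A\<bar>"
  unfolding cj_def by (subst tr_moebius_map) (simp_all add: det_cj trace_cj)

lemma elliptic_cj_iff: "det A = 1 \<Longrightarrow> elliptic (cj A) \<longleftrightarrow> \<bar>trace A\<bar> < 2"
  unfolding cj_def by (subst elliptic_moebius_map_iff) (simp_all add: det_cj trace_cj)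

lemma inv_cj:
  assumes "B ** A = mat 1" "det A > 0"
  shows "inv\<^bsub>moebius_group\<^esub> (cj A) = cj B"
proof -
  have "det B * det A = 1" using arg_cong[OF assms(1), of det] by (simp add: det_mul)
  then have B: "det B > 0" using assms(2) by (metis zero_less_mult_pos2 zero_less_one)
  show ?thesis
    by (rule group.inv_equality[OF group_moebius])
      (use assms B in \<open>simp_all add: cj_comp cj_mat_1\<close>)
qed

text \<open>The diagonal entries of the product are 1 + t (T + t) and 1 - t T, so \<open>T\<close>
  cancels from the trace. Hence \<bar>t\<bar> is the square root in the denominator of the bound on
  \<open>n\<close>.\<close>

lemma tr_commutator_cj:
  "tr (commutator (cj (transl t)) (cj (refl_transl T))) = 2 + t\<^sup>2"
proof -
  have 1: "inv\<^bsub>moebius_group\<^esub> (cj (transl t)) = cj (transl (- t))"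
    by (rule inv_cj) (simp_all add: mat_1_eq_mat2)
  have 2: "inv\<^bsub>moebius_group\<^esub> (cj (refl_transl T)) = cj (mat2 0 1 (- 1) T)"
    by (rule inv_cj) (simp_all add: mat_1_eq_mat2)
  have "tr (commutator (cj (transl t)) (cj (refl_transl T))) =
      tr (cj (transl t ** refl_transl T ** transl (- t) ** mat2 0 1 (- 1) T))"
    unfolding commutator_def 1 2 moebius_group_simps
    by (subst cj_comp, simp, simp)+ (rule refl)
  also have "\<dots> = \<bar>trace (transl t ** refl_transl T ** transl (- t) ** mat2 0 1 (- 1) T)\<bar>"
    by (rule tr_cj) (simp add: algebra_simps)
  also have "\<dots> = 2 + t\<^sup>2"
    by (simp add: algebra_simps power2_eq_square)
  finally show ?thesis .
qed

lemma cj_transl_pow: "cj (transl t) [^]\<^bsub>moebius_group\<^esub> (n::nat) = cj (transl (real n * t))"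
proof (induction n)
  case 0
  show ?case
    using monoid.nat_pow_0[OF group.is_monoid[OF group_moebius]] cj_mat_1
    by (simp add: mat_1_eq_mat2)
next
  case (Suc n)
  have "cj (transl t) [^]\<^bsub>moebius_group\<^esub> Suc n = cj (transl (real n * t)) \<circ> cj (transl t)"
    using monoid.nat_pow_Suc[OF group.is_monoid[OF group_moebius], of "cj (transl t)" n] Suc by simp
  also have "\<dots> = cj (transl (real (Suc n) * t))"
    by (subst cj_comp) (simp_all add: algebra_simps)
  finally show ?case .
qed

lemma cj_transl_pow_mult:
  "cj (transl t) [^]\<^bsub>moebius_group\<^esub> (n::nat) \<otimes>\<^bsub>moebius_group\<^esub> cj (refl_transl T) =
     cj (refl_transl (T + real n * t))"
  unfolding cj_transl_pow moebius_group_simps by (subst cj_comp) simp_all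

text \<open>Matrices with both off-diagonal entries below \<delta> in modulus form an open
  neighbourhood of the identity matrix (\<open>N\<close>, after conjugation). \<open>N\<close> is
  closed under change of sign, so it is the full preimage of its image \<open>U\<close> in the
  quotient, and \<open>U\<close> is open. As \<open>S\<close> misses \<open>U\<close> and
  \<open>U\<close> contains the identity, both conclusions follow at once.\<close>

lemma semidiscrete_inverse_freeI:
  assumes "\<delta> > 0"
    and gap: "\<And>h. h \<in> S \<Longrightarrow> \<exists>A. det A = 1 \<and> h = cj A \<and> (\<delta> \<le> \<bar>A$1$2\<bar> \<or> \<delta> \<le> \<bar>A$2$1\<bar>)"
  shows "semidiscrete S \<and> inverse_free S"
proof -
  define N where "N = {B \<in> SL2. \<bar>(Q ** B ** P)$1$2\<bar> < \<delta> \<and> \<bar>(Q ** B ** P)$2$1\<bar> < \<delta>}"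
  define U where "U = moebius_map ` N"
  have neg: "- B \<in> N" if "B \<in> N" for B
    using that by (simp add: N_def SL2_def matrix_mult_uminus_2)
  have cont: "continuous_on UNIV (\<lambda>B::real^2^2. (Q ** B ** P) $ i $ j)" for i j
    unfolding matrix_matrix_mult_def by (simp add: sum_2) (intro continuous_intros)
  have "open {B::real^2^2. \<bar>(Q ** B ** P)$1$2\<bar> < \<delta>}" "open {B::real^2^2. \<bar>(Q ** B ** P)$2$1\<bar> < \<delta>}"
    by (intro open_Collect_less continuous_intros cont)+
  then have "openin (top_of_set SL2) (SL2 \<inter> ({B. \<bar>(Q ** B ** P)$1$2\<bar> < \<delta>} \<inter> {B. \<bar>(Q ** B ** P)$2$1\<bar> < \<delta>}))"
    by (intro openin_open_Int open_Int)
  moreover have "{A \<in> SL2. moebius_map A \<in> U} = SL2 \<inter> ({B. \<bar>(Q ** B ** P)$1$2\<bar> < \<delta>} \<inter> {B. \<bar>(Q ** B ** P)$2$1\<bar> < \<delta>})"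
  proof -
    have "A \<in> N" if "A \<in> SL2" "B \<in> N" "moebius_map A = moebius_map B" for A B
    proof -
      have "A = B \<or> A = - B"
        using that moebius_map_eq_iff[of A B] by (simp add: SL2_def N_def)
      then show ?thesis using that neg by auto
    qed
    then have "{A \<in> SL2. moebius_map A \<in> U} = N" unfolding U_def by (auto simp: N_def)
    then show ?thesis by (auto simp: N_def)
  qed
  moreover have "U \<subseteq> carrier moebius_group"
    unfolding U_def N_def SL2_def by auto
  ultimately have op: "openin moebius_topology U" by (simp add: openin_moebius_topology)
  have "mat 1 \<in> N" using assms(1) by (simp add: N_def SL2_def QP) (simp add: mat_def)
  then have idU: "id \<in> U" unfolding U_def using moebius_map_id by (metis image_eqI)
  have disj: "h \<notin> U" if "h \<in> S" for h
  proof
    assume "h \<in> U"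
    then obtain B where B: "B \<in> N" "h = moebius_map B" by (auto simp: U_def)
    obtain A where A: "det A = 1" "h = cj A" "\<delta> \<le> \<bar>A$1$2\<bar> \<or> \<delta> \<le> \<bar>A$2$1\<bar>"
      using gap[OF \<open>h \<in> S\<close>] by blast
    have "P ** A ** Q = B \<or> P ** A ** Q = - B"
      using moebius_map_eq_iff[of "P ** A ** Q" B] A B by (simp add: det_cj cj_def N_def SL2_def)
    then have "P ** A ** Q \<in> N" using B neg by auto
    moreover have "Q ** (P ** A ** Q) ** P = (Q ** P) ** A ** (Q ** P)"
      by (simp add: matrix_mul_assoc)
    then have "Q ** (P ** A ** Q) ** P = A" by (simp add: QP)
    ultimately show False using A(3) by (simp add: N_def)
  qed
  have "\<not> (\<exists>y. y \<noteq> id \<and> y \<in> S \<and> y \<in> U)" using disj by blast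
  then have "id \<notin> moebius_topology derived_set_of S"
    unfolding in_derived_set_of using op idU by blast
  then show ?thesis unfolding semidiscrete_def inverse_free_def using idU disj by auto
qed

end

text \<open>The inductive definition multiplies arbitrary elements. Proving in addition that right
  multiplication by \<open>h\<close> preserves \<open>R\<close> reduces this to appending one
  generator at a time on the right, which suits an invariant of the bottom row.\<close>

lemma moebius_semigroup_induct [consumes 1]:
  assumes "h \<in> moebius_semigroup f g"
    and "R f" "R g" "\<And>h. R h \<Longrightarrow> R (h \<circ> f)" "\<And>h. R h \<Longrightarrow> R (h \<circ> g)"
  shows "R h"
proof -
  have "R h \<and> (\<forall>k. R k \<longrightarrow> R (k \<circ> h))"
    using assms(1)
  proof induction
    case (incl h)
    then show ?case using assms(2-5) by blast
  next
    case (mult h1 h2)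
    have "R (k \<circ> (h1 \<circ> h2))" if "R k" for k
      using mult.IH that by (metis comp_assoc)
    then show ?case using mult.IH unfolding moebius_group_simps by blast
  qed
  then show ?thesis by blast
qed

context moebius_conjugation
begin

lemma semigroup_gap:
  assumes "h \<in> moebius_semigroup (cj (transl t)) (cj (refl_transl T))"
    and T: "\<And>n::nat. \<bar>T + real n * t\<bar> \<ge> 2"
  shows "\<exists>A. det A = 1 \<and> h = cj A \<and> (\<bar>t\<bar> \<le> \<bar>A$1$2\<bar> \<or> 1 \<le> \<bar>A$2$1\<bar>)"
proof -
  \<comment> \<open>\<open>W\<close> is stable under right multiplication by both generators: once the bottom row satisfies
    $|d - ntc| \le |c|$, one has $|cT + d| \ge |T + nt| |c| - |c| \ge |c|$.\<close>
  define W where "W a b c d \<longleftrightarrow> a * d - b * c = 1 \<and>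
    ((\<exists>n::nat. 1 \<le> n \<and> a = 1 \<and> b = real n * t \<and> c = 0 \<and> d = 1) \<or>
     1 \<le> \<bar>c\<bar> \<and> (\<exists>n::nat. \<bar>d - real n * t * c\<bar> \<le> \<bar>c\<bar>))" for a b c d
  define R where "R h \<longleftrightarrow> (\<exists>a b c d. W a b c d \<and> h = cj (mat2 a b c d))" for h
  have "R h"
    using assms(1)
  proof (rule moebius_semigroup_induct)
    have "W 1 t 0 1" unfolding W_def by (auto intro: exI[of _ 1])
    then show "R (cj (transl t))" unfolding R_def by blast
    have "W T (- 1) 1 0" unfolding W_def by (auto intro: exI[of _ 0])
    then show "R (cj (refl_transl T))" unfolding R_def by blast
  next
    fix h assume "R h"
    then obtain a b c d where W: "W a b c d" and h: "h = cj (mat2 a b c d)" unfolding R_def by blast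
    have det: "a * d - b * c = 1" using W by (simp add: W_def)
    have "W a (a * t + b) c (c * t + d)"
    proof -
      have "a * (c * t + d) - (a * t + b) * c = 1" using det by (simp add: algebra_simps)
      moreover have ?thesis if "1 \<le> n" "a = 1" "b = real n * t" "c = 0" "d = 1" for n
        unfolding W_def using that by (auto intro!: exI[of _ "Suc n"] simp: algebra_simps)
      moreover have "\<exists>m::nat. \<bar>c * t + d - real m * t * c\<bar> \<le> \<bar>c\<bar>" if "\<bar>d - real n * t * c\<bar> \<le> \<bar>c\<bar>" for n
        using that by (intro exI[of _ "Suc n"]) (simp add: algebra_simps)
      ultimately show ?thesis using W unfolding W_def by blast
    qed
    moreover have "h \<circ> cj (transl t) = cj (mat2 a (a * t + b) c (c * t + d))"
      unfolding h using det by (subst cj_comp) simp_all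
    ultimately show "R (h \<circ> cj (transl t))" unfolding R_def by blast
    have "W (a * T + b) (- a) (c * T + d) (- c)"
    proof -
      have "\<bar>c\<bar> \<le> \<bar>c * T + d\<bar> \<and> 1 \<le> \<bar>c * T + d\<bar>"
      \<comment> \<open>\<open>c = 0\<close> with \<open>d = 1\<close> is a word in \<open>f\<close>
        alone; there the new lower left entry is 1.\<close>
      proof (cases "c = 0 \<and> d = 1")
        case False
        then obtain n :: nat where n: "1 \<le> \<bar>c\<bar>" "\<bar>d - real n * t * c\<bar> \<le> \<bar>c\<bar>"
          using W unfolding W_def by blast
        have "2 * \<bar>c\<bar> \<le> \<bar>T + real n * t\<bar> * \<bar>c\<bar>" using T[of n] by (intro mult_right_mono) auto
        also have "\<dots> = \<bar>(c * T + d) - (d - real n * t * c)\<bar>"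
          unfolding abs_mult[symmetric] by (simp add: algebra_simps)
        also have "\<dots> \<le> \<bar>c * T + d\<bar> + \<bar>c\<bar>" using n(2) by linarith
        finally show ?thesis using n(1) by linarith
      qed auto
      moreover have "(a * T + b) * (- c) - (- a) * (c * T + d) = 1"
        using det by (simp add: algebra_simps)
      ultimately show ?thesis unfolding W_def by (auto intro: exI[of _ 0])
    qed
    moreover have "h \<circ> cj (refl_transl T) = cj (mat2 (a * T + b) (- a) (c * T + d) (- c))"
      unfolding h using det by (subst cj_comp) simp_all
    ultimately show "R (h \<circ> cj (refl_transl T))" unfolding R_def by blast
  qed
  then obtain a b c d where W: "W a b c d" and h: "h = cj (mat2 a b c d)" unfolding R_def by blast
  \<comment> \<open>Words in \<open>f\<close> alone have \<bar>b\<bar> = n \<bar>t\<bar>, and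
    \<open>1 \<le> n\<close> in \<open>W\<close> keeps them away from the identity; all others have
    \<bar>c\<bar> at least 1.\<close>
  have "\<bar>t\<bar> \<le> \<bar>b\<bar> \<or> 1 \<le> \<bar>c\<bar>"
  proof (cases "1 \<le> \<bar>c\<bar>")
    case False
    then obtain n :: nat where "1 \<le> n" "b = real n * t" using W unfolding W_def by blast
    then show ?thesis using mult_right_mono[of 1 "real n" "\<bar>t\<bar>"] by (simp add: abs_mult)
  qed simp
  then show ?thesis using W h by (intro exI[of _ "mat2 a b c d"]) (simp add: W_def)
qed

end

section \<open>Powers of an elliptic element\<close>

text \<open>\<open>E\<close> is a rotation, an element of a one-parameter group at parameter
  \<theta>. Dirichlet approximation makes some k \<theta> with k > 0 arbitrarily close to a multiple
  of pi, and multiples of pi give plus or minus the identity matrix, hence the identity map. The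
  k-th power is either the identity, against inverse freeness, or a different element near it,
  against semidiscreteness; finite and infinite order need no separate treatment.\<close>

lemma elliptic_powers_accumulate:
  assumes E: "det E = 1" "\<bar>trace E\<bar> < 2"
    and S: "\<And>k. 1 \<le> k \<Longrightarrow> (moebius_map E ^^ k) \<in> S"
  shows "\<not> (semidiscrete S \<and> inverse_free S)"
proof
  assume "semidiscrete S \<and> inverse_free S"
  then have sd: "id \<notin> moebius_topology derived_set_of S" and nid: "id \<notin> S"
    by (auto simp: semidiscrete_def inverse_free_def)
  obtain a b c d where abcd: "E = mat2 a b c d" by (rule mat2_cases)
  have det: "a * d - b * c = 1" and tr: "\<bar>a + d\<bar> < 2" using E abcd by simp_all
  define \<theta> where "\<theta> = arccos ((a + d) / 2)"
  have cos: "cos \<theta> = (a + d) / 2" unfolding \<theta>_def using tr by (intro cos_arccos) auto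
  have "0 < \<theta> \<and> \<theta> < pi" unfolding \<theta>_def using tr by (intro arccos_lt_bounded) auto
  then have sin: "sin \<theta> > 0" by (simp add: sin_gt_zero)
  \<comment> \<open>The entries of (E - cos \<theta>) / sin \<theta>, a trace-free matrix of
    determinant 1, whose square is -1 by Cayley-Hamilton.\<close>
  define p where "p = (a - d) / 2 / sin \<theta>"
  define q where "q = b / sin \<theta>"
  define r where "r = c / sin \<theta>"
  have "(sin \<theta>)\<^sup>2 = 1 - ((a + d) / 2)\<^sup>2" using sin_squared_eq[of \<theta>] cos by simp
  also have "\<dots> = - ((a - d) / 2)\<^sup>2 - b * c"
    using det by (simp add: power2_eq_square field_simps)
  also have "\<dots> = (sin \<theta>)\<^sup>2 * (- p\<^sup>2 - q * r)"
    unfolding p_def q_def r_def using sin by (simp add: power2_eq_square field_simps)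
  finally have pqr: "p * p = - 1 - q * r" using sin by (simp add: power2_eq_square)
  \<comment> \<open>The one-parameter group through \<open>E\<close>: \<open>R x = cos x + sin x K\<close> with $K^2 = -1$.\<close>
  define R where "R x = mat2 (cos x + p * sin x) (q * sin x) (r * sin x) (cos x - p * sin x)" for x
  have R_add: "R x ** R y = R (x + y)" for x y
  proof -
    have 1: "p * sin x * (p * sin y) = - (sin x * sin y) - q * sin x * (r * sin y)"
    proof -
      have "p * sin x * (p * sin y) = (p * p) * (sin x * sin y)" by (simp add: mult_ac)
      also have "\<dots> = - (sin x * sin y) - q * sin x * (r * sin y)"
        unfolding pqr by (simp add: algebra_simps)
      finally show ?thesis .
    qed
    show ?thesis
      unfolding R_def mat2_mult mat2_eq_iff cos_add sin_add
      using 1 by (simp add: algebra_simps)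
  qed
  have det_R: "det (R x) = 1" for x
  proof -
    have "det (R x) = (cos x)\<^sup>2 - (p * p) * (sin x)\<^sup>2 - q * r * (sin x)\<^sup>2"
      by (simp add: R_def power2_eq_square algebra_simps)
    also have "\<dots> = (cos x)\<^sup>2 + (sin x)\<^sup>2" unfolding pqr by (simp add: algebra_simps)
    finally show ?thesis by simp
  qed
  have R_E: "R \<theta> = E"
  proof -
    have "p * sin \<theta> = (a - d) / 2" "q * sin \<theta> = b" "r * sin \<theta> = c"
      using sin by (simp_all add: p_def q_def r_def)
    then show ?thesis unfolding R_def abcd mat2_eq_iff cos by (simp add: field_simps)
  qed
  have R_0: "R 0 = mat 1" by (simp add: R_def mat_1_eq_mat2)
  have pow: "moebius_map E ^^ k = moebius_map (R (real k * \<theta>))" for k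
  proof (induction k)
    case 0
    show ?case by (simp add: R_0 moebius_map_id)
  next
    case (Suc k)
    have "moebius_map E ^^ Suc k = moebius_map (R \<theta>) \<circ> moebius_map (R (real k * \<theta>))"
      by (simp add: Suc R_E)
    also have "\<dots> = moebius_map (R \<theta> ** R (real k * \<theta>))"
      by (simp add: moebius_map_mult det_R)
    also have "R \<theta> ** R (real k * \<theta>) = R (real (Suc k) * \<theta>)"
      unfolding R_add by (simp add: algebra_simps)
    finally show ?case .
  qed
  have R_pi: "moebius_map (R (of_int h * pi)) = id" for h :: int
  proof -
    have "R (of_int h * pi) = mat 1 \<or> R (of_int h * pi) = - mat 1"
      unfolding R_def mat_1_eq_mat2 using cos_npi_int[of h] sin_npi_int[of h]
      by (auto simp: mult.commute)
    then show ?thesis using moebius_map_id by auto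
  qed
  obtain U where U: "openin moebius_topology U" "id \<in> U"
    and sep: "\<And>y. y \<in> S \<Longrightarrow> y \<in> U \<Longrightarrow> y = id"
  proof -
    have "id \<in> topspace moebius_topology"
      unfolding topspace_moebius_topology using moebius_map_in_carrier[of "mat 1"]
      by (simp add: moebius_map_id)
    then show ?thesis using sd that unfolding in_derived_set_of by blast
  qed
  have "openin (top_of_set SL2) {A \<in> SL2. moebius_map A \<in> U}"
    using U(1) by (simp add: openin_moebius_topology)
  then obtain V where V: "open V" "{A \<in> SL2. moebius_map A \<in> U} = SL2 \<inter> V"
    unfolding openin_open by blast
  have R_eq: "R x = cos x *\<^sub>R mat 1 + sin x *\<^sub>R mat2 p q r (- p)" for x
    by (simp add: R_def mat_1_eq_mat2 vec_eq_iff forall_2)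
  have "continuous_on UNIV R" unfolding R_eq by (intro continuous_intros)
  then have "open (R -` V)" using V(1) by (intro open_vimage)
  moreover have "0 \<in> R -` V"
  proof -
    have "R 0 \<in> {A \<in> SL2. moebius_map A \<in> U}"
      using U(2) moebius_map_id by (simp add: R_0 SL2_def)
    then show ?thesis unfolding V(2) by simp
  qed
  ultimately have "\<exists>e>0. \<forall>x. dist x 0 < e \<longrightarrow> x \<in> R -` V"
    unfolding open_dist by blast
  then obtain e where e: "e > 0" "\<And>x. \<bar>x\<bar> < e \<Longrightarrow> R x \<in> V"
    by auto
  \<comment> \<open>Dirichlet's error 1/N in units of pi must stay below \<open>e\<close>, hence N >
    pi/e.\<close>
  obtain N :: nat where N: "pi / e < real N" using reals_Archimedean2 by blast
  then have "N > 0" using e(1) by (cases N) (auto simp: field_simps dest: order.strict_trans[OF pi_gt_zero])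
  then obtain h k where hk: "0 < k" "\<bar>of_int k * (\<theta> / pi) - of_int h\<bar> < 1 / N"
    using Dirichlet_approx[of N "\<theta> / pi"] by metis
  define x where "x = of_int k * \<theta> - of_int h * pi"
  have "x = (of_int k * (\<theta> / pi) - of_int h) * pi" by (simp add: x_def algebra_simps)
  then have "\<bar>x\<bar> = \<bar>of_int k * (\<theta> / pi) - of_int h\<bar> * pi" by (simp add: abs_mult)
  also have "\<dots> < 1 / N * pi" using hk(2) by (intro mult_strict_right_mono) auto
  also have "\<dots> < e" using N \<open>N > 0\<close> e(1) by (simp add: field_simps)
  finally have "R x \<in> V" by (rule e(2))
  then have "R x \<in> SL2 \<inter> V" using det_R by (simp add: SL2_def)
  then have "moebius_map (R x) \<in> U" unfolding V(2)[symmetric] by simp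
  moreover have "moebius_map E ^^ nat k = moebius_map (R x)"
  proof -
    have "real (nat k) * \<theta> = x + of_int h * pi" using hk(1) by (simp add: x_def)
    then have "moebius_map E ^^ nat k = moebius_map (R x ** R (of_int h * pi))"
      unfolding pow R_add by simp
    then show ?thesis by (simp add: moebius_map_mult det_R R_pi)
  qed
  moreover have "moebius_map E ^^ nat k \<in> S" using hk(1) by (intro S) simp
  ultimately show False using sep nid by metis
qed

section \<open>Reduction to the normal form\<close>

lemma common_fixed_point_elementary:
  assumes "p \<in> closed_half_plane" "f p = p" "g p = p"
  shows "elementary (moebius_semigroup f g)"
proof -
  have "h p = p" if "h \<in> moebius_semigroup f g" for h
    using that by (rule moebius_semigroup_induct) (use assms in auto)
  then have "{h p | h. h \<in> moebius_semigroup f g} \<subseteq> {p}" by auto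
  then have "finite {h p | h. h \<in> moebius_semigroup f g}" by (rule finite_subset) simp
  then show ?thesis unfolding elementary_def using assms(1) by blast
qed

text \<open>\<open>P0\<close> sends infinity to the fixed point of \<open>f\<close>, so that
  \<open>f\<close> becomes a translation. The affine map \<open>L\<close>, z -> c z + d, then moves
  the pole of \<open>g\<close> to 0 and makes its lower left entry 1. This requires \<open>c\<close>
  to be nonzero: otherwise \<open>g\<close> would share the fixed point of \<open>f\<close>, and the
  semigroup would be elementary.\<close>

lemma parabolic_hyperbolic_normal_form:
  assumes f: "parabolic f" and g: "hyperbolic g" and ne: "\<not> elementary (moebius_semigroup f g)"
  obtains P Q t T where "P ** Q = mat 1" "det P > 0" "t \<noteq> 0" "\<bar>T\<bar> > 2"
    "f = moebius_map (P ** transl t ** Q)" "g = moebius_map (P ** refl_transl T ** Q)"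
proof -
  obtain A where A: "det A = 1" "f = moebius_map A"
    using f unfolding parabolic_def carrier_moebius_group_iff by blast
  obtain B where B: "det B = 1" "g = moebius_map B"
    using g unfolding hyperbolic_def carrier_moebius_group_iff by blast
  have trB: "\<bar>trace B\<bar> > 2" using hyperbolic_moebius_map_imp B g by blast
  obtain p where p: "p \<in> ext_real" "f p = p" and p_unique: "\<And>q. q \<in> ext_real \<Longrightarrow> f q = q \<Longrightarrow> q = p"
    using f unfolding parabolic_def by metis
  obtain P0 Q0 where PQ0: "P0 ** Q0 = mat 1" "det P0 = 1" "moebius_map P0 None = p"
    using p(1)
  proof (cases p rule: ext_real_cases)
    case 1
    show ?thesis by (rule that[of "mat 1" "mat 1"]) (simp_all add: moebius_map_id 1)
  next
    case (2 x)
    show ?thesis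
      by (rule that[of "mat2 x (- 1) 1 0" "mat2 0 1 (- 1) x"]) (simp_all add: mat_1_eq_mat2 2)
  qed
  interpret c0: moebius_conjugation P0 Q0 by unfold_locales (use PQ0 in simp_all)
  have detQ0: "det Q0 = 1" using c0.det_P_Q PQ0(2) by simp
  have unconj: "P0 ** (Q0 ** X ** P0) ** Q0 = X" for X
  proof -
    have "P0 ** (Q0 ** X ** P0) ** Q0 = (P0 ** Q0) ** X ** (P0 ** Q0)"
      by (simp add: matrix_mul_assoc)
    then show ?thesis by (simp add: PQ0(1))
  qed
  have det': "det (Q0 ** X ** P0) = det X" for X by (simp add: det_mul detQ0 PQ0(2))
  obtain t0 where t0: "t0 \<noteq> 0" "f = c0.cj (transl t0)"
  proof -
    obtain a b c d where abcd: "Q0 ** A ** P0 = mat2 a b c d" by (rule mat2_cases)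
    have det: "a * d - b * c = 1" using det'[of A] A(1) abcd by simp
    have f': "f = c0.cj (mat2 a b c d)"
      unfolding c0.cj_def abcd[symmetric] unconj by (rule A(2))
    have fp: "f (moebius_map P0 q) = moebius_map P0 (moebius_map (mat2 a b c d) q)" for q
      unfolding f' using det by (intro c0.cj_apply) simp
    have "moebius_map (mat2 a b c d) None = None" using fp[of None] p PQ0(3) by simp
    then have c: "c = 0" by (simp split: if_splits)
    have u: "q = None" if "q \<in> ext_real" "moebius_map (mat2 a b c d) q = q" for q
      using that fp[of q] p_unique[of "moebius_map P0 q"] PQ0(3) by (metis c0.map_P_eq_iff c0.map_P_ext_real_iff)
    have ad: "a * d = 1" using det c by simp
    then have d0: "d \<noteq> 0" by auto
    have "a = d"
    proof (rule ccontr)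
      assume "a \<noteq> d"
      \<comment> \<open>b / (d - a) would be a second fixed point of the affine map.\<close>
      then have "(a * (b / (d - a)) + b) / d = b / (d - a)" using d0 by (simp add: field_simps)
      then have "moebius_map (mat2 a b c d) (Some (of_real (b / (d - a)))) = Some (of_real (b / (d - a)))"
        unfolding moebius_map_mat2_real using c d0 by simp
      then show False using u[of "Some (of_real (b / (d - a)))"] by simp
    qed
    then have "a = 1 \<or> a = - 1" using ad by (simp add: square_eq_1_iff)
    have "b \<noteq> 0"
    proof
      assume "b = 0"
      then have "moebius_map (mat2 a b c d) (Some (of_real 0)) = Some (of_real 0)"
        unfolding moebius_map_mat2_real using d0 by simp
      then show False using u[of "Some (of_real 0)"] by simp
    qed
    have "mat2 a b c d = transl (a * b) \<or> mat2 a b c d = - transl (a * b)"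
      using c \<open>a = d\<close> \<open>a = 1 \<or> a = - 1\<close> by auto
    then have "f = c0.cj (transl (a * b))"
      unfolding f' c0.cj_def by (auto simp: matrix_mult_uminus_2 simp del: mat2_uminus)
    moreover have "a * b \<noteq> 0" using \<open>a = 1 \<or> a = - 1\<close> \<open>b \<noteq> 0\<close> by auto
    ultimately show ?thesis using that by blast
  qed
  obtain a b c d where g': "g = c0.cj (mat2 a b c d)" and det: "a * d - b * c = 1"
    and c: "c > 0" and tr: "\<bar>a + d\<bar> > 2"
  proof -
    obtain a b c d where abcd: "Q0 ** B ** P0 = mat2 a b c d" by (rule mat2_cases)
    have det: "a * d - b * c = 1" using det'[of B] B(1) abcd by simp
    have g': "g = c0.cj (mat2 a b c d)"
      unfolding c0.cj_def abcd[symmetric] unconj by (rule B(2))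
    have "trace (P0 ** (Q0 ** B ** P0) ** Q0) = a + d"
      unfolding abcd c0.trace_cj by simp
    then have tr: "\<bar>a + d\<bar> > 2" using trB unconj by simp
    have "c \<noteq> 0"
    proof
      assume "c = 0"
      then have "g p = p"
        unfolding g' PQ0(3)[symmetric] using det by (subst c0.cj_apply) simp_all
      then show False
        using common_fixed_point_elementary[of p f g] p ne by (auto simp: closed_half_plane_def)
    qed
    then consider "c > 0" | "c < 0" by linarith
    then show ?thesis
    proof cases
      case 1
      then show ?thesis using that g' det tr by blast
    next
      case 2
      \<comment> \<open>Changing the sign of the matrix makes the lower left entry positive, so that
        \<open>L\<close> and \<open>M\<close> have positive determinant.\<close>
      have "g = c0.cj (- mat2 a b c d)"
        unfolding g' c0.cj_def by (simp add: matrix_mult_uminus_2 del: mat2_uminus)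
      then show ?thesis using that[of "- a" "- b" "- c" "- d"] 2 det tr by simp
    qed
  qed
  define L where "L = mat2 c d 0 1"
  define M where "M = mat2 (1 / c) (- d / c) 0 1"
  have LM: "M ** L = mat 1" "L ** M = mat 1" using c by (simp_all add: L_def M_def mat_1_eq_mat2)
  have conj: "P0 ** M ** (L ** X ** M) ** (L ** Q0) = P0 ** X ** Q0" for X
  proof -
    have "P0 ** M ** (L ** X ** M) ** (L ** Q0) = P0 ** (M ** L) ** X ** (M ** L) ** Q0"
      by (simp add: matrix_mul_assoc)
    then show ?thesis by (simp add: LM)
  qed
  have t: "L ** transl t0 ** M = transl (c * t0)"
    using c by (simp add: L_def M_def)
  \<comment> \<open>The conjugated matrix has upper right entry b c - a d, which is -1 by the
    determinant condition.\<close>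
  have T: "L ** mat2 a b c d ** M = refl_transl (a + d)"
  proof -
    have "b * (c * c) + c = a * (c * d)" using arg_cong[OF det, of "\<lambda>x. c * x"] by (simp add: algebra_simps)
    then show ?thesis using c by (simp add: L_def M_def field_simps)
  qed
  show ?thesis
  proof (rule that[of "P0 ** M" "L ** Q0" "c * t0" "a + d"])
    have "P0 ** M ** (L ** Q0) = P0 ** (M ** L) ** Q0" by (simp add: matrix_mul_assoc)
    then show "P0 ** M ** (L ** Q0) = mat 1" by (simp add: LM PQ0)
    show "det (P0 ** M) > 0" using c by (simp add: det_mul PQ0 M_def)
    show "c * t0 \<noteq> 0" using c t0 by simp
    show "f = moebius_map (P0 ** M ** transl (c * t0) ** (L ** Q0))"
      unfolding t[symmetric] conj using t0(2) by (simp only: c0.cj_def)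
    show "g = moebius_map (P0 ** M ** refl_transl (a + d) ** (L ** Q0))"
      unfolding T[symmetric] conj using g' by (simp only: c0.cj_def)
  qed (rule tr)
qed

section \<open>Attracting fixed points and antiparallel pairs\<close>

lemma limitin_sphere_power:
  assumes "norm c > 1" "z \<noteq> 0"
  shows "limitin sphere_topology (\<lambda>n. Some (c ^ n * z)) None sequentially"
  unfolding limitin_def
proof (intro conjI allI impI)
  fix U assume U: "openin sphere_topology U \<and> None \<in> U"
  have "filterlim (\<lambda>n. c ^ n) at_infinity sequentially"
    using assms(1) by (rule filterlim_realpow_sequentially_gt1)
  moreover have "((\<lambda>n. z) \<longlongrightarrow> z) sequentially" by simp
  ultimately have "filterlim (\<lambda>n. z * c ^ n) at_infinity sequentially"
    using assms(2) by (intro tendsto_mult_filterlim_at_infinity)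
  moreover have "eventually (\<lambda>z. Some z \<in> U) at_infinity" using U by (simp add: openin_sphere_iff)
  ultimately show "eventually (\<lambda>n. Some (c ^ n * z) \<in> U) sequentially"
    unfolding filterlim_iff by (auto simp: mult.commute)
qed simp

context moebius_conjugation
begin

text \<open>diag(l, 1/l) acts as multiplication by l^2 > 1, so every orbit except the fixed points 0
  and infinity tends to infinity. Since the sphere is Hausdorff, the orbit of 1 alone already
  determines the attracting point.\<close>

lemma attracting_fixed_point_cj_diagonal:
  assumes l: "\<bar>l\<bar> > 1"
  shows "attracting_fixed_point (cj (mat2 l 0 0 (1 / l))) = moebius_map P None"
proof -
  define D where "D = mat2 l 0 0 (1 / l)"
  have l0: "l \<noteq> 0" using l by auto
  have det: "det D \<noteq> 0" using l0 by (simp add: D_def)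
  have D_Some: "moebius_map D (Some w) = Some (of_real (l\<^sup>2) * w)" for w
    using l0 by (simp add: D_def moebius_map_mat2_Some power2_eq_square)
  have D_pow: "(moebius_map D ^^ n) (Some w) = Some (of_real (l\<^sup>2) ^ n * w)" for n w
    by (induction n) (simp_all add: D_Some)
  have cj_pow: "(cj D ^^ n) (moebius_map P w) = moebius_map P ((moebius_map D ^^ n) w)" for n w
    by (induction n) (simp_all add: cj_apply det)
  have D_None: "moebius_map D None = None" by (simp add: D_def)
  have l2: "norm (complex_of_real (l\<^sup>2)) > 1"
    using l one_less_power[of "\<bar>l\<bar>" 2] unfolding norm_of_real by simp
  have lim: "limitin sphere_topology (\<lambda>n. (cj D ^^ n) z) (moebius_map P None) sequentially"
    if z: "cj D z \<noteq> z" for z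
  proof -
    define w where "w = moebius_map Q z"
    have zw: "z = moebius_map P w" by (simp add: w_def)
    have "moebius_map D w \<noteq> w" using z unfolding zw cj_apply[OF det] by simp
    then obtain v where v: "w = Some v" "v \<noteq> 0"
      using D_None D_Some[of 0] by (cases w) auto
    have "limitin sphere_topology (moebius_map P \<circ> (\<lambda>n. Some (of_real (l\<^sup>2) ^ n * v))) (moebius_map P None) sequentially"
      by (rule continuous_map_limit[OF continuous_map_moebius_map limitin_sphere_power])
        (use det_P l2 v in simp_all)
    then show ?thesis unfolding zw cj_pow v(1) D_pow comp_def .
  qed
  have "attracting_fixed_point (cj D) = moebius_map P None"
    unfolding attracting_fixed_point_def
  proof (rule the_equality)
    show "moebius_map P None \<in> ext_real \<and> cj D (moebius_map P None) = moebius_map P None \<and>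
      (\<forall>z \<in> closed_half_plane. cj D z \<noteq> z \<longrightarrow>
        limitin sphere_topology (\<lambda>n. (cj D ^^ n) z) (moebius_map P None) sequentially)"
      using lim det D_None by (simp add: cj_apply)
  next
    fix q assume q: "q \<in> ext_real \<and> cj D q = q \<and>
      (\<forall>z \<in> closed_half_plane. cj D z \<noteq> z \<longrightarrow>
        limitin sphere_topology (\<lambda>n. (cj D ^^ n) z) q sequentially)"
    let ?z = "moebius_map P (Some 1)"
    have "?z \<in> closed_half_plane" by (simp add: closed_half_plane_def)
    moreover have "of_real (l\<^sup>2) \<noteq> (1::complex)" using l2 by auto
    then have ne: "cj D ?z \<noteq> ?z" unfolding cj_apply[OF det] D_Some by simp
    ultimately have "limitin sphere_topology (\<lambda>n. (cj D ^^ n) ?z) q sequentially" using q by blast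
    then show "q = moebius_map P None"
      using limitin_Hausdorff_unique[OF _ lim[OF ne] trivial_limit_sequentially Hausdorff_space_sphere]
      by blast
  qed
  then show ?thesis by (simp add: D_def)
qed

text \<open>The fixed points of z -> (l + 1/l) - 1/z are l and 1/l. Conjugation by
  \<open>P ** R\<close> is a second instance of the locale in which the same transformation is
  diagonal, and there infinity corresponds to l.\<close>

lemma attracting_fixed_point_cj_refl_transl:
  assumes l: "\<bar>l\<bar> > 1"
  shows "attracting_fixed_point (cj (refl_transl (l + 1 / l))) = moebius_map P (Some (of_real l))"
proof -
  define s where "s = sgn l"
  have l0: "l \<noteq> 0" using l by auto
  have s0: "s \<noteq> 0" "s * l = \<bar>l\<bar>" using l0 by (simp_all add: s_def sgn_if)
  define \<delta> where "\<delta> = s * (l - 1 / l)"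
  have "s * (1 / l) = 1 / \<bar>l\<bar>" using l0 by (simp add: s_def sgn_if)
  then have "\<delta> = \<bar>l\<bar> - 1 / \<bar>l\<bar>" unfolding \<delta>_def right_diff_distrib s0(2) by simp
  moreover have "1 / \<bar>l\<bar> < 1" using l by simp
  ultimately have \<delta>: "\<delta> > 0" using l by linarith
  \<comment> \<open>The columns of \<open>R\<close> are eigenvectors; the sign \<open>s\<close> makes its determinant \<open>\<delta>\<close> positive.\<close>
  define R where "R = mat2 l (s / l) 1 s"
  define R' where "R' = mat2 (s / \<delta>) (- s / l / \<delta>) (- 1 / \<delta>) (l / \<delta>)"
  have RR: "R ** R' = mat 1"
    using \<delta> l0 unfolding R_def R'_def mat_1_eq_mat2 mat2_mult mat2_eq_iff
    by (simp add: divide_simps) (simp add: \<delta>_def algebra_simps)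
  interpret c: moebius_conjugation "P ** R" "R' ** Q"
  proof
    have "P ** R ** (R' ** Q) = P ** (R ** R') ** Q" by (simp add: matrix_mul_assoc)
    then show "P ** R ** (R' ** Q) = mat 1" by (simp add: RR PQ)
    have "det R = \<delta>" by (simp add: R_def \<delta>_def algebra_simps)
    then show "det (P ** R) > 0" using det_P \<delta> by (simp add: det_mul)
  qed
  have "refl_transl (l + 1 / l) ** R = R ** mat2 l 0 0 (1 / l)"
    using l0 by (simp add: R_def field_simps)
  then have "R ** mat2 l 0 0 (1 / l) ** R' = refl_transl (l + 1 / l) ** (R ** R')"
    by (metis matrix_mul_assoc)
  then have e: "R ** mat2 l 0 0 (1 / l) ** R' = refl_transl (l + 1 / l)" by (simp add: RR)
  have "P ** R ** mat2 l 0 0 (1 / l) ** (R' ** Q) = P ** (R ** mat2 l 0 0 (1 / l) ** R') ** Q"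
    by (simp add: matrix_mul_assoc)
  then have "c.cj (mat2 l 0 0 (1 / l)) = cj (refl_transl (l + 1 / l))"
    unfolding c.cj_def cj_def e by simp
  moreover have "moebius_map (P ** R) None = moebius_map P (Some (of_real l))"
    using c.det_P det_P by (subst moebius_map_mult) (auto simp: R_def det_mul)
  ultimately show ?thesis using c.attracting_fixed_point_cj_diagonal[OF l] by simp
qed

lemma fixed_cj_transl_iff:
  assumes "t \<noteq> 0"
  shows "cj (transl t) p = p \<longleftrightarrow> p = moebius_map P None"
proof -
  define w where "w = moebius_map Q p"
  have p: "p = moebius_map P w" by (simp add: w_def)
  have "cj (transl t) p = p \<longleftrightarrow> moebius_map (transl t) w = w"
    unfolding p by (subst cj_apply) simp_all
  also have "\<dots> \<longleftrightarrow> w = None" using assms by (cases w) (simp_all add: moebius_map_mat2_Some)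
  finally show ?thesis unfolding p by simp
qed

lemma alpha_cj_transl:
  assumes "t \<noteq> 0"
  shows "alpha (cj (transl t)) = moebius_map P None"
proof -
  have "{p \<in> ext_real. cj (transl t) p = p} = {moebius_map P None}"
    using fixed_cj_transl_iff[OF assms] by auto
  then have "\<not> hyperbolic (cj (transl t))" unfolding hyperbolic_def by simp
  then show ?thesis
    unfolding alpha_def using fixed_cj_transl_iff[OF assms] by (auto intro!: the_equality)
qed

end

text \<open>\<open>l\<close> is the root of larger modulus of l^2 - T l + 1 = 0. It has the sign of
  \<open>T\<close>, which fixes the side of 0 on which the attracting point of \<open>g\<close>
  lies.\<close>

lemma eigenvalue_exists:
  fixes T :: real
  assumes "\<bar>T\<bar> > 2"
  obtains l where "\<bar>l\<bar> > 1" "T = l + 1 / l" "T * l > 0"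
proof -
  have pos: "\<exists>l>1. T = l + 1 / l" if "T > 2" for T :: real
  proof -
    define r where "r = sqrt (T\<^sup>2 - 4)"
    have "2\<^sup>2 < T\<^sup>2" using that by (intro power_strict_mono) auto
    then have r: "r\<^sup>2 = T\<^sup>2 - 4" "r \<ge> 0" by (simp_all add: r_def)
    define l where "l = (T + r) / 2"
    have "l > 1" using that r by (simp add: l_def)
    moreover have "l * T = l * l + 1"
      using r(1) unfolding l_def by (simp add: power2_eq_square field_simps)
    then have "T = l + 1 / l" using \<open>l > 1\<close> by (simp add: field_simps)
    ultimately show ?thesis by blast
  qed
  consider "T > 2" | "- T > 2" using assms by linarith
  then show ?thesis
  proof cases
    case 1
    then obtain l where "l > 1" "T = l + 1 / l" using pos by blast
    then show ?thesis using that[of l] 1 by simp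
  next
    case 2
    then obtain l where "l > 1" "- T = l + 1 / l" using pos by blast
    then show ?thesis using that[of "- l"] 2 by (simp add: mult_less_0_iff)
  qed
qed

context moebius_conjugation
begin

text \<open>For l > 0 the interval \<open>J\<close> is [l, infinity]; translation maps it onto
  [l + t, infinity], and z -> T - 1/z maps it onto [l, T]. The first image omits l and the second
  omits infinity, so both inclusions are strict. For l < 0 the picture is reflected.\<close>

lemma not_antiparallel:
  assumes T: "\<bar>T\<bar> > 2" and t: "T * t > 0" and g: "hyperbolic (cj (refl_transl T))"
  shows "\<not> antiparallel (cj (transl t)) (cj (refl_transl T))"
proof -
  obtain l where l: "\<bar>l\<bar> > 1" "T = l + 1 / l" "T * l > 0" using eigenvalue_exists[OF T] .
  have t0: "t \<noteq> 0" using t by auto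
  have "alpha (cj (refl_transl T)) = attracting_fixed_point (cj (refl_transl T))"
    using g by (simp add: alpha_def)
  also have "\<dots> = moebius_map P (Some (of_real l))"
    unfolding l(2) by (rule attracting_fixed_point_cj_refl_transl[OF l(1)])
  finally have alpha_g: "alpha (cj (refl_transl T)) = moebius_map P (Some (of_real l))" .
  define I where "I = (if l > 0 then {l<..} else {..<l})"
  define K where "K = (if l > 0 then {..<l} else {l<..})"
  have IK: "I = {l<..} \<and> K = {..<l} \<or> I = {..<l} \<and> K = {l<..}" by (simp add: I_def K_def)
  define J where "J = insert None (Some ` complex_of_real ` insert l I)"
  note J = closed_interval_ray[OF IK, folded J_def]
  have ci: "closed_interval (moebius_map P ` J)"
    and ep: "end_points (moebius_map P ` J) = {alpha (cj (transl t)), alpha (cj (refl_transl T))}"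
    using closed_interval_moebius_map[OF PQ J(1)] J(2) alpha_cj_transl[OF t0] alpha_g by simp_all
  have sign: "l > 1 \<and> t > 0 \<or> l < - 1 \<and> t < 0"
    using l(1,3) t by (auto simp: zero_less_mult_iff)
  have J_iff: "Some (of_real x) \<in> J \<longleftrightarrow> (if l > 0 then x \<ge> l else x \<le> l)" for x
    by (auto simp: J_def I_def)
  have J_cases: "p = None \<or> (\<exists>x. p = Some (of_real x) \<and> (if l > 0 then x \<ge> l else x \<le> l))"
    if "p \<in> J" for p using that by (auto simp: J_def I_def)
  have None_J: "None \<in> J" by (simp add: J_def)
  have transl_real: "moebius_map (transl t) (Some (of_real x)) = Some (of_real (x + t))" for x
    unfolding moebius_map_mat2_real by simp
  have "moebius_map (transl t) ` J \<subseteq> J"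
  proof
    fix q assume "q \<in> moebius_map (transl t) ` J"
    then obtain p where p: "p \<in> J" "q = moebius_map (transl t) p" by blast
    from J_cases[OF p(1)] show "q \<in> J"
    proof (elim disjE exE conjE)
      fix x assume "p = Some (of_real x)" "if l > 0 then x \<ge> l else x \<le> l"
      then show ?thesis unfolding p(2) using sign by (auto simp: transl_real J_iff simp del: of_real_add)
    qed (simp add: p None_J)
  qed
  moreover have "Some (of_real l) \<notin> moebius_map (transl t) ` J"
  proof
    assume "Some (of_real l) \<in> moebius_map (transl t) ` J"
    then obtain p where p: "p \<in> J" "Some (of_real l) = moebius_map (transl t) p" by blast
    from J_cases[OF p(1)] show False
    proof (elim disjE exE conjE)
      fix x assume x: "p = Some (of_real x)" "if l > 0 then x \<ge> l else x \<le> l"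
      then have "l = x + t" using p(2) unfolding x(1) transl_real by (simp del: of_real_add)
      then show False using x(2) sign by auto
    qed (use p in simp)
  qed
  moreover have "Some (of_real l) \<in> J" by (simp add: J_def)
  ultimately have "moebius_map (transl t) ` J \<subset> J" by blast
  then have "moebius_map P ` moebius_map (transl t) ` J \<subset> moebius_map P ` J"
    by (intro image_strict_mono) (auto simp: inj_on_def)
  then have f: "maps_strictly_inside (cj (transl t)) (moebius_map P ` J)"
    unfolding maps_strictly_inside_def by (subst cj_image) simp_all
  have "moebius_map (refl_transl T) ` J \<subseteq> J"
  proof
    fix q assume "q \<in> moebius_map (refl_transl T) ` J"
    then obtain p where p: "p \<in> J" "q = moebius_map (refl_transl T) p" by blast
    from J_cases[OF p(1)] show "q \<in> J"
    proof (elim disjE exE conjE)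
      assume "p = None"
      then have "q = Some (of_real T)" by (simp add: p(2))
      moreover have "if l > 0 then T \<ge> l else T \<le> l" using l(2) by auto
      ultimately show ?thesis by (simp only: J_iff)
    next
      fix x assume x: "p = Some (of_real x)" "if l > 0 then x \<ge> l else x \<le> l"
      have "x \<noteq> 0" using x(2) sign by auto
      then have "q = Some (of_real (T - 1 / x))"
        unfolding p(2) x(1) moebius_map_mat2_real by (simp add: field_simps)
      \<comment> \<open>-1/x increases on each side of 0, and T - 1/l = l.\<close>
      moreover have "if l > 0 then T - 1 / x \<ge> l else T - 1 / x \<le> l"
        using x(2) sign le_imp_inverse_le[of l x] le_imp_inverse_le_neg[of x l]
        unfolding l(2) by (auto simp: divide_inverse)
      ultimately show ?thesis by (simp only: J_iff)
    qed
  qed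
  moreover have "None \<notin> moebius_map (refl_transl T) ` J"
  proof
    assume "None \<in> moebius_map (refl_transl T) ` J"
    then obtain p where p: "p \<in> J" "None = moebius_map (refl_transl T) p" by blast
    from J_cases[OF p(1)] show False
    proof (elim disjE exE conjE)
      fix x assume x: "p = Some (of_real x)" "if l > 0 then x \<ge> l else x \<le> l"
      then have "x = 0" using p(2) unfolding x(1) moebius_map_mat2_real by (simp split: if_splits)
      then show False using x(2) sign by auto
    qed (use p in simp)
  qed
  ultimately have "moebius_map (refl_transl T) ` J \<subset> J" using None_J by blast
  then have "moebius_map P ` moebius_map (refl_transl T) ` J \<subset> moebius_map P ` J"
    by (intro image_strict_mono) (auto simp: inj_on_def)
  then have "maps_strictly_inside (cj (refl_transl T)) (moebius_map P ` J)"
    unfolding maps_strictly_inside_def by (subst cj_image) simp_all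
  then show ?thesis unfolding antiparallel_def using ci ep f by blast
qed

section \<open>Schottky groups\<close>

lemma cj_image_complement_closure:
  assumes "det A \<noteq> 0" "X \<subseteq> ext_real"
    and "moebius_map A ` (ext_real - circle_topology closure_of X) = Y"
  shows "cj A ` (ext_real - circle_topology closure_of (moebius_map P ` X)) = moebius_map P ` Y"
proof -
  have "circle_topology closure_of (moebius_map P ` X) = moebius_map P ` (circle_topology closure_of X)"
    using homeomorphic_map_closure_of[OF homeomorphic_map_moebius_map_circle[OF PQ]] assms(2) by simp
  moreover have "ext_real = moebius_map P ` ext_real"
    using homeomorphic_imp_surjective_map[OF homeomorphic_map_moebius_map_circle[OF PQ]] by simp
  ultimately have "ext_real - circle_topology closure_of (moebius_map P ` X) =
      moebius_map P ` (ext_real - circle_topology closure_of X)"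
    using image_set_diff[of "moebius_map P" ext_real "circle_topology closure_of X"]
    by (simp add: inj_on_def)
  then show ?thesis using assms(1,3) by (simp add: cj_image)
qed

text \<open>All four intervals can be given by sets of reals: infinity lies in none of them, being
  the common end point of the two half-lines that the translation pairs.\<close>

lemma Schottky_rank_twoI:
  fixes A B C D :: "real set"
  assumes fh: "det F > 0" "det H > 0"
    and "open A" "connected A" "A \<noteq> {}" "open B" "connected B" "B \<noteq> {}"
    and "open C" "connected C" "C \<noteq> {}" "open D" "connected D" "D \<noteq> {}"
    and disj: "disjnt A B" "disjnt A C" "disjnt A D" "disjnt B C" "disjnt B D" "disjnt C D"
    and H: "moebius_map H ` (ext_real - circle_topology closure_of (Some ` of_real ` A)) = Some ` of_real ` B"
    and F: "moebius_map F ` (ext_real - circle_topology closure_of (Some ` of_real ` C)) = Some ` of_real ` D"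
  shows "Schottky_rank_two (generate moebius_group {cj H, cj F})"
proof -
  let ?I = "\<lambda>X::real set. moebius_map P ` Some ` complex_of_real ` X"
  have "open_interval (?I A)" "open_interval (?I B)" "open_interval (?I C)" "open_interval (?I D)"
    using assms by (auto intro!: open_interval_moebius_map[OF PQ] open_interval_real)
  moreover have "disjnt (?I X) (?I Y)" if "disjnt X Y" for X Y
    using that by (auto simp: disjnt_iff)
  moreover have "cj H ` (ext_real - circle_topology closure_of (?I A)) = ?I B"
    by (rule cj_image_complement_closure) (use fh H in auto)
  moreover have "cj F ` (ext_real - circle_topology closure_of (?I C)) = ?I D"
    by (rule cj_image_complement_closure) (use fh F in auto)
  ultimately show ?thesis
    unfolding Schottky_rank_two_def using disj cj_carrier[OF fh(1)] cj_carrier[OF fh(2)] by blast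
qed

text \<open>With h = f^m g one has g = f^(-m) h, so the group generated by \<open>h\<close> and
  \<open>f\<close> contains \<open>g\<close> and hence the whole semigroup.\<close>

lemma semigroup_subset_generate:
  fixes m :: nat and t T :: real
  defines "\<Gamma> \<equiv> generate moebius_group {cj (refl_transl (T + real m * t)), cj (transl t)}"
  shows "moebius_semigroup (cj (transl t)) (cj (refl_transl T)) \<subseteq> \<Gamma>"
proof -
  have sub: "subgroup \<Gamma> moebius_group"
    unfolding \<Gamma>_def by (intro group.generate_is_subgroup[OF group_moebius]) auto
  have mult: "x \<circ> y \<in> \<Gamma>" if "x \<in> \<Gamma>" "y \<in> \<Gamma>" for x y
    using subgroup.m_closed[OF sub that] by simp
  have f: "cj (transl t) \<in> \<Gamma>" and h: "cj (refl_transl (T + real m * t)) \<in> \<Gamma>"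
    unfolding \<Gamma>_def by (auto intro: generate.incl)
  have "cj (transl (real n * t)) \<in> \<Gamma>" for n
  proof (induction n)
    case 0
    have "cj (mat 1) \<in> \<Gamma>" using subgroup.one_closed[OF sub] unfolding cj_mat_1 by simp
    then show ?case by (simp add: mat_1_eq_mat2)
  next
    case (Suc n)
    have "cj (transl (real n * t)) \<circ> cj (transl t) \<in> \<Gamma>" using Suc f by (rule mult)
    also have "cj (transl (real n * t)) \<circ> cj (transl t) = cj (transl (real (Suc n) * t))"
      by (subst cj_comp) (simp_all add: algebra_simps)
    finally show ?case .
  qed
  then have "inv\<^bsub>moebius_group\<^esub> (cj (transl (real m * t))) \<in> \<Gamma>"
    using subgroup.m_inv_closed[OF sub] by blast
  also have "inv\<^bsub>moebius_group\<^esub> (cj (transl (real m * t))) = cj (transl (- (real m * t)))"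
    by (rule inv_cj) (simp_all add: mat_1_eq_mat2)
  finally have "cj (transl (- (real m * t))) \<circ> cj (refl_transl (T + real m * t)) \<in> \<Gamma>"
    using h by (rule mult)
  also have "cj (transl (- (real m * t))) \<circ> cj (refl_transl (T + real m * t)) = cj (refl_transl T)"
    by (subst cj_comp) simp_all
  finally have g: "cj (refl_transl T) \<in> \<Gamma>" .
  have "h \<in> \<Gamma>" if "h \<in> moebius_semigroup (cj (transl t)) (cj (refl_transl T))" for h
    using that by (rule moebius_semigroup_induct) (use f g mult in blast)+
  then show ?thesis by blast
qed

end

lemma ext_real_minus_image_real:
  "ext_real - Some ` complex_of_real ` X = insert None (Some ` complex_of_real ` (- X))"
  "ext_real - insert None (Some ` complex_of_real ` X) = Some ` complex_of_real ` (- X)"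
  by (auto simp: ext_real_def Reals_def)

lemma refl_transl_image:
  fixes T :: real
  shows "moebius_map (refl_transl T) ` (ext_real - circle_topology closure_of (Some ` of_real ` {-1<..<1})) =
    Some ` of_real ` {T - 1<..<T + 1}" (is "?L = ?R")
proof -
  have e: "ext_real - circle_topology closure_of (Some ` of_real ` {-1<..<1}) =
      insert None (Some ` complex_of_real ` (- {-1..1}))"
    by (simp add: closure_of_circle ext_real_minus_image_real)
  have real: "moebius_map (refl_transl T) (Some (of_real x)) = Some (of_real (T - 1 / x))"
    if "x \<notin> {-1..1}" for x
  proof -
    have "x \<noteq> 0" using that by auto
    then show ?thesis unfolding moebius_map_mat2_real by (simp add: field_simps)
  qed
  have None: "moebius_map (refl_transl T) None = Some (of_real T)" by simp
  show ?thesis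
  proof (intro equalityI subsetI)
    fix q assume "q \<in> ?L"
    then consider "q = Some (of_real T)" | x where "x \<notin> {-1..1}" "q = Some (of_real (T - 1 / x))"
      unfolding e using None real by auto
    then show "q \<in> ?R"
    proof cases
      case 2
      then have "\<bar>x\<bar> > 1" by auto
      then have "\<bar>1 / x\<bar> < 1" by simp
      then have "T - 1 / x \<in> {T - 1<..<T + 1}" by (auto simp del: abs_divide)
      then show ?thesis using 2 by blast
    qed auto
  next
    fix q assume "q \<in> ?R"
    then obtain y where y: "q = Some (of_real y)" "\<bar>T - y\<bar> < 1" by (auto simp: abs_less_iff)
    show "q \<in> ?L"
    proof (cases "y = T")
      case True
      then have "q = moebius_map (refl_transl T) None" using y None by simp
      then show ?thesis unfolding e by blast
    next
      case False
      define x where "x = 1 / (T - y)"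
      have "\<bar>x\<bar> > 1" using y(2) False by (simp add: x_def)
      then have x: "x \<notin> {-1..1}" by auto
      have "q = moebius_map (refl_transl T) (Some (of_real x))"
        unfolding real[OF x] y(1) by (simp add: x_def)
      then show ?thesis unfolding e using x by blast
    qed
  qed
qed

lemma transl_image_ray:
  fixes t p :: real
  shows "moebius_map (transl t) ` (ext_real - circle_topology closure_of (Some ` of_real ` {p<..})) =
      Some ` of_real ` {..<p + t}"
    "moebius_map (transl t) ` (ext_real - circle_topology closure_of (Some ` of_real ` {..<p})) =
      Some ` of_real ` {p + t<..}"
proof -
  have real: "moebius_map (transl t) ` Some ` complex_of_real ` X = Some ` of_real ` ((\<lambda>x. x + t) ` X)" for X
    by (simp add: image_image moebius_map_mat2_Some)
  have "(\<lambda>x. x + t) ` {..<p} = {..<p + t}" "(\<lambda>x. x + t) ` {p<..} = {p + t<..}"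
    by (force intro: image_eqI[of _ _ "_ - t"])+
  then show "moebius_map (transl t) ` (ext_real - circle_topology closure_of (Some ` of_real ` {p<..})) =
      Some ` of_real ` {..<p + t}"
    "moebius_map (transl t) ` (ext_real - circle_topology closure_of (Some ` of_real ` {..<p})) =
      Some ` of_real ` {p + t<..}"
    using not_bounded_ray
    by (simp_all add: closure_of_circle ext_real_minus_image_real real Compl_atLeast Compl_atMost)
qed

text \<open>At the first index where u - n v falls below 2 the gap forces it to at most -2. That
  index is positive because u > 2, so it has a predecessor \<open>m\<close>.\<close>

lemma multiple_skipping_interval:
  fixes u v :: real
  assumes "u > 2" "v > 0" and skip: "\<And>n::nat. \<bar>u - real n * v\<bar> \<ge> 2"
  obtains m :: nat where "u - real m * v \<ge> 2" "u - real (Suc m) * v \<le> - 2"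
proof -
  obtain N :: nat where "u / v < real N" using reals_Archimedean2 by blast
  then have ex: "u - real N * v < 2" using assms by (simp add: field_simps)
  define n where "n = (LEAST n::nat. u - real n * v < 2)"
  have n: "u - real n * v < 2" unfolding n_def using ex by (rule LeastI)
  have "n \<noteq> 0" using n assms(1) by (intro notI) simp
  then obtain m where m: "n = Suc m" by (cases n) auto
  have "\<not> u - real m * v < 2"
    using not_less_Least[of m "\<lambda>n. u - real n * v < 2"] m unfolding n_def by simp
  moreover have "u - real n * v \<le> - 2" using skip[of n] n by linarith
  ultimately show ?thesis using that[of m] m by simp
qed

context moebius_conjugation
begin

lemma semigroup_in_Schottky_group:
  assumes T: "\<bar>T\<bar> > 2" and t: "T * t < 0" and skip: "\<And>n::nat. \<bar>T + real n * t\<bar> \<ge> 2"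
  shows "\<exists>\<Gamma>. Schottky_rank_two \<Gamma> \<and> moebius_semigroup (cj (transl t)) (cj (refl_transl T)) \<subseteq> \<Gamma>"
proof -
  have "\<exists>m::nat. Schottky_rank_two (generate moebius_group {cj (refl_transl (T + real m * t)), cj (transl t)})"
  proof (cases "T > 0")
    case True
    then have "T > 2" "- t > 0" using T t by (auto simp: mult_less_0_iff)
    moreover have "\<bar>T - real n * (- t)\<bar> \<ge> 2" for n :: nat using skip[of n] by simp
    ultimately obtain m :: nat where m: "T - real m * (- t) \<ge> 2" "T - real (Suc m) * (- t) \<le> - 2"
      by (rule multiple_skipping_interval)
    define S where "S = T + real m * t"
    have S: "S \<ge> 2" "S + t \<le> - 2" using m by (simp_all add: S_def algebra_simps)
    \<comment> \<open>The four sets are (-1, 1), (S - 1, S + 1), (S + 1, infinity) and (-infinity, S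
      + 1 + t). S >= 2 separates the first two, and S + t <= -2 places the last one to the left of
      -1.\<close>
    have "Schottky_rank_two (generate moebius_group {cj (refl_transl S), cj (transl t)})"
      by (rule Schottky_rank_twoI[OF _ _ _ _ _ _ _ _ _ _ _ _ _ _ _ _ _ _ _ _ refl_transl_image transl_image_ray(1)[where p = "S + 1"]])
        (use S in \<open>auto simp: disjnt_iff\<close>)
    then show ?thesis unfolding S_def by blast
  next
    case False
    then have "- T > 2" "t > 0" using T t by (auto simp: mult_less_0_iff)
    moreover have "\<bar>- T - real n * t\<bar> \<ge> 2" for n :: nat using skip[of n] by linarith
    ultimately obtain m :: nat where m: "- T - real m * t \<ge> 2" "- T - real (Suc m) * t \<le> - 2"
      by (rule multiple_skipping_interval)
    define S where "S = T + real m * t"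
    have S: "S \<le> - 2" "S + t \<ge> 2" using m by (simp_all add: S_def algebra_simps)
    \<comment> \<open>The mirror image: the rays are (-infinity, S - 1) and (S - 1 + t, infinity),
      and the latter starts at 1 or beyond.\<close>
    have "Schottky_rank_two (generate moebius_group {cj (refl_transl S), cj (transl t)})"
      by (rule Schottky_rank_twoI[OF _ _ _ _ _ _ _ _ _ _ _ _ _ _ _ _ _ _ _ _ refl_transl_image transl_image_ray(2)[where p = "S - 1"]])
        (use S in \<open>auto simp: disjnt_iff\<close>)
    then show ?thesis unfolding S_def by blast
  qed
  then show ?thesis using semigroup_subset_generate by blast
qed

section \<open>The trace criterion and the finite range of exponents\<close>

lemma pow_mult_in_semigroup:
  "cj (refl_transl (T + real n * t)) \<in> moebius_semigroup (cj (transl t)) (cj (refl_transl T))"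
proof (induction n)
  case 0
  show ?case by (auto intro: semigroup_generated.incl)
next
  case (Suc n)
  have "cj (transl t) \<in> moebius_semigroup (cj (transl t)) (cj (refl_transl T))"
    by (auto intro: semigroup_generated.incl)
  from semigroup_generated.mult[OF this Suc]
  have "cj (transl t) \<circ> cj (refl_transl (T + real n * t)) \<in>
      moebius_semigroup (cj (transl t)) (cj (refl_transl T))" by simp
  also have "cj (transl t) \<circ> cj (refl_transl (T + real n * t)) = cj (refl_transl (T + real (Suc n) * t))"
    by (subst cj_comp) (simp_all add: algebra_simps)
  finally show ?case .
qed

lemma semidiscrete_inverse_free_iff:
  fixes t T :: real
  assumes t: "t \<noteq> 0"
  defines "S \<equiv> moebius_semigroup (cj (transl t)) (cj (refl_transl T))"
  shows "semidiscrete S \<and> inverse_free S \<longleftrightarrow> (\<forall>n::nat. \<bar>T + real n * t\<bar> \<ge> 2)"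
proof
  assume skip: "\<forall>n::nat. \<bar>T + real n * t\<bar> \<ge> 2"
  show "semidiscrete S \<and> inverse_free S"
  proof (rule semidiscrete_inverse_freeI)
    \<comment> \<open>One gap for both kinds of words: \<bar>t\<bar> for the upper right entry of
      powers of \<open>f\<close>, and 1 for the lower left entry of all others.\<close>
    show "min 1 \<bar>t\<bar> > 0" using t by simp
    fix h assume "h \<in> S"
    then obtain A where "det A = 1" "h = cj A" "\<bar>t\<bar> \<le> \<bar>A$1$2\<bar> \<or> 1 \<le> \<bar>A$2$1\<bar>"
      using semigroup_gap skip unfolding S_def by blast
    then show "\<exists>A. det A = 1 \<and> h = cj A \<and> (min 1 \<bar>t\<bar> \<le> \<bar>A$1$2\<bar> \<or> min 1 \<bar>t\<bar> \<le> \<bar>A$2$1\<bar>)"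
      by (intro exI[of _ A]) auto
  qed
next
  assume L: "semidiscrete S \<and> inverse_free S"
  show "\<forall>n::nat. \<bar>T + real n * t\<bar> \<ge> 2"
  proof (rule ccontr)
    assume "\<not> (\<forall>n::nat. \<bar>T + real n * t\<bar> \<ge> 2)"
    then obtain n :: nat where n: "\<bar>T + real n * t\<bar> < 2" by (auto simp: not_le)
    define h where "h = cj (refl_transl (T + real n * t))"
    have h: "h \<in> S" unfolding h_def S_def by (rule pow_mult_in_semigroup)
    have "(h ^^ Suc k) \<in> S" for k
    proof (induction k)
      case (Suc k)
      show ?case using semigroup_generated.mult[OF h[unfolded S_def] Suc[unfolded S_def]]
        unfolding S_def by (simp add: comp_def)
    qed (use h in simp)
    then have "(h ^^ k) \<in> S" if "1 \<le> k" for k using that by (cases k) auto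
    then have "\<not> (semidiscrete S \<and> inverse_free S)"
      unfolding h_def cj_def
      by (rule elliptic_powers_accumulate[rotated 2]) (use n in \<open>simp_all add: det_cj trace_cj\<close>)
    then show False using L by blast
  qed
qed

end

theorem theorem12p4:
  fixes f g :: "complex option \<Rightarrow> complex option"
  assumes "parabolic f"
    and "hyperbolic g"
    and "\<not> elementary (moebius_semigroup f g)"
  shows "tr (commutator f g) > 2 \<and>
    (semidiscrete (moebius_semigroup f g) \<and> inverse_free (moebius_semigroup f g) \<longleftrightarrow>
       (\<forall>n::nat. 1 \<le> n \<and> real n \<le> 2 * tr g / sqrt (tr (commutator f g) - 2) \<longrightarrow>
          \<not> elliptic (f [^]\<^bsub>moebius_group\<^esub> n \<otimes>\<^bsub>moebius_group\<^esub> g))) \<and>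
    (antiparallel f g \<and> semidiscrete (moebius_semigroup f g) \<and>
       inverse_free (moebius_semigroup f g) \<longrightarrow>
       (\<exists>\<Gamma>. Schottky_rank_two \<Gamma> \<and> moebius_semigroup f g \<subseteq> \<Gamma>))"
proof -
  obtain P Q t T where PQ: "P ** Q = mat 1" "det P > 0" and t: "t \<noteq> 0" and T: "\<bar>T\<bar> > 2"
    and fg: "f = moebius_map (P ** transl t ** Q)" "g = moebius_map (P ** refl_transl T ** Q)"
    using parabolic_hyperbolic_normal_form[OF assms] .
  interpret moebius_conjugation P Q by unfold_locales (rule PQ)+
  have f: "f = cj (transl t)" and g: "g = cj (refl_transl T)" unfolding fg cj_def by (rule refl)+
  have tr: "tr (commutator f g) = 2 + t\<^sup>2" unfolding f g by (rule tr_commutator_cj)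
  have bound: "2 * tr g / sqrt (tr (commutator f g) - 2) = 2 * \<bar>T\<bar> / \<bar>t\<bar>"
    using tr by (simp add: g tr_cj)
  have elliptic: "elliptic (f [^]\<^bsub>moebius_group\<^esub> n \<otimes>\<^bsub>moebius_group\<^esub> g) \<longleftrightarrow> \<bar>T + real n * t\<bar> < 2"
    for n :: nat
    unfolding f g cj_transl_pow_mult by (subst elliptic_cj_iff) simp_all
  have sd: "semidiscrete (moebius_semigroup f g) \<and> inverse_free (moebius_semigroup f g) \<longleftrightarrow>
      (\<forall>n::nat. \<bar>T + real n * t\<bar> \<ge> 2)"
    unfolding f g by (rule semidiscrete_inverse_free_iff[OF t])
  \<comment> \<open>Outside the range the condition is automatic. At n = 0 it reads \<bar>T\<bar> >=
    2, and \<bar>T\<bar> > 2 since \<open>g\<close> is hyperbolic. Beyond the bound n \<bar>t\<bar>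
    > 2 \<bar>T\<bar>, so the triangle inequality gives \<bar>T + n t\<bar> > \<bar>T\<bar> > 2;
    this is the origin of the factor 2.\<close>
  also have "\<dots> \<longleftrightarrow> (\<forall>n::nat. 1 \<le> n \<and> real n \<le> 2 * \<bar>T\<bar> / \<bar>t\<bar> \<longrightarrow> \<bar>T + real n * t\<bar> \<ge> 2)"
  proof -
    have "\<bar>T + real n * t\<bar> \<ge> 2" if "\<not> (1 \<le> n \<and> real n \<le> 2 * \<bar>T\<bar> / \<bar>t\<bar>)" for n :: nat
    proof (cases "n = 0")
      case False
      then have "2 * \<bar>T\<bar> < real n * \<bar>t\<bar>" using that t by (simp add: field_simps)
      then have "2 * \<bar>T\<bar> < \<bar>real n * t\<bar>" by (simp add: abs_mult)
      then show ?thesis using T by linarith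
    qed (use T in simp)
    then show ?thesis by blast
  qed
  finally have iff: "semidiscrete (moebius_semigroup f g) \<and> inverse_free (moebius_semigroup f g) \<longleftrightarrow>
      (\<forall>n::nat. 1 \<le> n \<and> real n \<le> 2 * \<bar>T\<bar> / \<bar>t\<bar> \<longrightarrow> \<bar>T + real n * t\<bar> \<ge> 2)" .
  have "\<exists>\<Gamma>. Schottky_rank_two \<Gamma> \<and> moebius_semigroup f g \<subseteq> \<Gamma>"
    if "antiparallel f g" "semidiscrete (moebius_semigroup f g)" "inverse_free (moebius_semigroup f g)"
  proof -
    have "\<not> T * t > 0" using not_antiparallel[OF T] that(1) assms(2) unfolding f g by blast
    moreover have "T * t \<noteq> 0" using t T by auto
    ultimately have "T * t < 0" by linarith
    then show ?thesis
      unfolding f g using T that(2,3) sd by (intro semigroup_in_Schottky_group) auto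
  qed
  moreover have "tr (commutator f g) > 2" using tr t by simp
  ultimately show ?thesis
    unfolding bound elliptic not_less using iff by blast
qed

end
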